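(* Let $\alpha,\beta\in(0,1)$. For every $m\in\{1,2,\dots\}$ and every junction tree $T_+\in\mathsf{T}_{m+1}$, the transition probability $\mathbf{R}_m$ of the junction-tree collapser and the transition probability $\mathbf{K}_m=\mathbf{K}_m^{\alpha,\beta}$ of the junction-tree expander satisfy: (i) $\operatorname{Supp}(\mathbf{R}_m(T_+,\cdot))\subseteq\mathsf{T}_m$; (ii) $\operatorname{Supp}(\mathbf{R}_m(T_+,\cdot))\subseteq\operatorname{Supp}(\mathbf{K}_m(\cdot,T_+))$; (iii) $g(T)=g(T_+)[\{y_\ell\}_{\ell=1}^m]$ for every $T\in\operatorname{Supp}(\mathbf{R}_m(T_+,\cdot))$.
   Context: Graphs are finite, undirected, without loops. A clique is a complete vertex set that is maximal with respect to inclusion. $G[W]$ is the subgraph of $G$ induced by the vertex set $W$. A graph $G$ is decomposable if its cliques can be arranged in a junction tree, i.e. a tree whose nodes are the cliques of $G$ and such that for any two cliques $c,c'$ the intersection $c\cap c'$ is contained in every node on the unique path between $c$ and $c'$ (junction tree property). Edges of a junction tree are called links; the link $(a,b)$ has associated separator $s_{a,b}=a\cap b$ (which may be empty). Fix distinct vertices $y_1,y_2,\dots$. $\mathsf{T}_m$ is the set of all junction trees of all decomposable graphs with vertex set $\{y_1,\dots,y_m\}$. For a tree $T$ whose nodes are sets of vertices, $g(T)$ is the underlying graph: its vertex set is the union of the nodes, and two distinct vertices are adjacent iff they belong to a common node. $N_T(c)$ is the set of neighbors of node $c$ in $T$. $\operatorname{Supp}(h)=\{x:h(x)>0\}$. Subtree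 kernel. For a tree $T=(V,E)$ a random (possibly empty) subtree $T'=(V',E')$ is drawn with probability $\mathbf{S}^{\alpha,\beta}(T,T')=1-\beta$ if $T'=(\emptyset,\emptyset)$ and $\beta|V'|\alpha^{|V'|-1}(1-\alpha)^{w}/|V|$ otherwise, where $w$ is the number of connected components of $T[V\setminus V']$. (A subtree is a connected subgraph.) Junction-tree expander. Given $T=(V,E)\in\mathsf{T}_m$, draw $T'=(V',E')\sim\mathbf{S}^{\alpha,\beta}(T,\cdot)$. If $T'$ is empty: add the new node $\{y_{m+1}\}$ to $T$, joined by a link to an arbitrary node of $T$; delete all links with empty separator; and reconnect the resulting forest into a tree by adding links, chosen uniformly at random among all possible ways to do so. Output this tree. If $T'$ is nonempty: enumerate $V'=\{c_1,\dots,c_{|V'|}\}$. For each $j$ put $z_j=\bigcup_{c\in N_{T'}(c_j)}s_{c_j,c}$. Independently over $j$, draw $q_j$ uniformly from the nonempty subsets of $c_j\setminus z_j$ if $z_j=s_{c_j,c}$ for some $c\in N_{T'}(c_j)$, and uniformly from all subsets of $c_j\setminus z_j$ otherwise. Put $d_j=z_j\cup q_j$ and add the new node $d_j^+=d_j\cup\{y_{m+1}\}$. For each link $(c_j,c_k)$ of $T'$, remove this link and add the link $(d_j^+,d_k^+)$. For each $j$ with $d_j=c_j$, delete the node $c_j$ and let all of $N_T(c_j)\setminus V'$ become neighbors of $d_j^+$. For each $j$ with $d_j\neq c_j$, add the link $(c_j,d_j^+)$, draw $n_j$ uniformly from the subsets of $\{c\in N_T(c_j)\setminus V': s_{c,c_j}\subseteq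 d_j\}$, and move the nodes in $n_j$ from being neighbors of $c_j$ to being neighbors of $d_j^+$. Output the resulting tree. $\mathbf{K}_m(T,T_+)$ denotes the probability that this procedure outputs $T_+$ when the input is $T$. Junction-tree collapser. Given $T_+=(V_+,E_+)\in\mathsf{T}_{m+1}$: If $\{y_{m+1}\}\in V_+$: remove the node $\{y_{m+1}\}$ and its incident links, and connect the resulting forest (possibly a single tree) into a tree by adding links, chosen uniformly at random among all possible ways to do so. Output this tree. If $\{y_{m+1}\}\notin V_+$: let $T_+'=(V_+',E_+')$ be the subtree of $T_+$ induced by the nodes containing $y_{m+1}$, and enumerate $V_+'=\{d_1^+,\dots,d_{|V_+'|}^+\}$. For each $j$, independently, let $M_j=\{c\in N_{T_+}(d_j^+): s_{c,d_j^+}=d_j^+\setminus\{y_{m+1}\}\}$; if $M_j=\emptyset$ put $c_j=d_j^+\setminus\{y_{m+1}\}$, otherwise draw $c_j$ uniformly from $M_j$. Replace each node $d_j^+$ by $c_j$: all neighbors of $d_j^+$ other than $c_j$ become neighbors of $c_j$ (a neighbor $d_k^+\in V_+'$ being itself replaced by $c_k$), and $d_j^+$ with its incident links is removed. Output the result. $\mathbf{R}_m(T_+,T)$ denotes the probability that this procedure outputs $T$ when the input is $T_+$. *)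

theory Defs
  imports "HOL-Probability.Product_PMF"
begin

section \<open>Finite simple graphs\<close>

type_synonym 'a graph = "'a set \<times> 'a set set"

abbreviation verts :: "'a graph \<Rightarrow> 'a set" where "verts \<equiv> fst"
abbreviation edges :: "'a graph \<Rightarrow> 'a set set" where "edges \<equiv> snd"

definition simple_graph :: "'a graph \<Rightarrow> bool" where
  "simple_graph G \<longleftrightarrow> finite (verts G) \<and> (\<forall>e\<in>edges G. e \<subseteq> verts G \<and> card e = 2)"

definition neighbours :: "'a graph \<Rightarrow> 'a \<Rightarrow> 'a set" where
  "neighbours G v = {u. {u, v} \<in> edges G}"

definition induced :: "'a graph \<Rightarrow> 'a set \<Rightarrow> 'a graph" where
  "induced G W = (verts G \<inter> W, {e \<in> edges G. e \<subseteq> W})"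

definition graph_path :: "'a graph \<Rightarrow> 'a \<Rightarrow> 'a list \<Rightarrow> 'a \<Rightarrow> bool" where
  "graph_path G u p v \<longleftrightarrow> p \<noteq> [] \<and> hd p = u \<and> last p = v \<and> distinct p \<and>
     set p \<subseteq> verts G \<and> successively (\<lambda>a b. {a, b} \<in> edges G) p"

definition graph_cycle :: "'a graph \<Rightarrow> 'a list \<Rightarrow> bool" where
  "graph_cycle G p \<longleftrightarrow> 3 \<le> length p \<and> graph_path G (hd p) p (last p) \<and> {last p, hd p} \<in> edges G"

text \<open>The empty graph counts as connected, so that it is a (possibly empty) subtree of every tree.\<close>

definition graph_connected :: "'a graph \<Rightarrow> bool" where
  "graph_connected G \<longleftrightarrow> (\<forall>u\<in>verts G. \<forall>v\<in>verts G. \<exists>p. graph_path G u p v)"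

definition components :: "'a graph \<Rightarrow> 'a set set" where
  "components G = (\<lambda>u. {v. \<exists>p. graph_path G u p v}) ` verts G"

definition is_tree :: "'a graph \<Rightarrow> bool" where
  "is_tree G \<longleftrightarrow> simple_graph G \<and> graph_connected G \<and> (\<nexists>p. graph_cycle G p)"

definition is_subtree :: "'a graph \<Rightarrow> 'a graph \<Rightarrow> bool" where
  "is_subtree T' T \<longleftrightarrow> simple_graph T' \<and> verts T' \<subseteq> verts T \<and> edges T' \<subseteq> edges T \<and>
     graph_connected T'"

text \<open>All trees obtained from the forest \<open>F\<close> by adding links between existing nodes.\<close>

definition tree_completions :: "'a graph \<Rightarrow> 'a graph set" where
  "tree_completions F = {T. is_tree T \<and> verts T = verts F \<and> edges F \<subseteq> edges T}"


section \<open>Junction trees\<close>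

definition complete_in :: "'v graph \<Rightarrow> 'v set \<Rightarrow> bool" where
  "complete_in G W \<longleftrightarrow> W \<subseteq> verts G \<and> (\<forall>u\<in>W. \<forall>v\<in>W. u \<noteq> v \<longrightarrow> {u, v} \<in> edges G)"

definition cliques :: "'v graph \<Rightarrow> 'v set set" where
  "cliques G = {W. complete_in G W \<and> (\<forall>W'. complete_in G W' \<and> W \<subseteq> W' \<longrightarrow> W' = W)}"

definition junction_tree_of :: "'v graph \<Rightarrow> 'v set graph \<Rightarrow> bool" where
  "junction_tree_of G T \<longleftrightarrow> is_tree T \<and> verts T = cliques G \<and>
     (\<forall>c\<in>verts T. \<forall>c'\<in>verts T. \<forall>p. graph_path T c p c' \<longrightarrow> (\<forall>b\<in>set p. c \<inter> c' \<subseteq> b))"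

definition decomposable :: "'v graph \<Rightarrow> bool" where
  "decomposable G \<longleftrightarrow> (\<exists>T. junction_tree_of G T)"

definition junction_trees :: "(nat \<Rightarrow> 'v) \<Rightarrow> nat \<Rightarrow> 'v set graph set" where
  "junction_trees y m =
     {T. \<exists>G. simple_graph G \<and> verts G = y ` {1..m} \<and> decomposable G \<and> junction_tree_of G T}"

definition underlying_graph :: "'v set graph \<Rightarrow> 'v graph" where
  "underlying_graph T = (\<Union>(verts T), {{u, v} | u v. u \<noteq> v \<and> (\<exists>c\<in>verts T. u \<in> c \<and> v \<in> c)})"

definition Supp :: "('a \<Rightarrow> real) \<Rightarrow> 'a set" where
  "Supp h = {x. h x > 0}"


section \<open>Expander\<close>

definition subtree_kernel :: "real \<Rightarrow> real \<Rightarrow> 'a graph \<Rightarrow> 'a graph \<Rightarrow> real" where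
  "subtree_kernel \<alpha> \<beta> T T' =
     (if \<not> is_subtree T' T then 0
      else if T' = ({}, {}) then 1 - \<beta>
      else \<beta> * real (card (verts T')) * \<alpha> ^ (card (verts T') - 1) *
           (1 - \<alpha>) ^ card (components (induced T (verts T - verts T'))) / real (card (verts T)))"

text \<open>The node to which \<open>{x}\<close> is first linked is arbitrary: that link has empty separator and is
  deleted again. The separator of a link \<open>e = {a, b}\<close> is \<open>\<Inter>e = a \<inter> b\<close>.\<close>

definition expand_empty :: "'v \<Rightarrow> 'v set graph \<Rightarrow> 'v set graph pmf" where
  "expand_empty x T =
     (let c = (SOME c. c \<in> verts T);
          E = insert {{x}, c} (edges T)
      in pmf_of_set (tree_completions (insert {x} (verts T), {e \<in> E. \<Inter>e \<noteq> {}})))"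

definition separator_union :: "'v set graph \<Rightarrow> 'v set \<Rightarrow> 'v set" where
  "separator_union T' c = (\<Union>b\<in>neighbours T' c. c \<inter> b)"

definition draw_q :: "'v set graph \<Rightarrow> 'v set \<Rightarrow> 'v set pmf" where
  "draw_q T' c =
     (let z = separator_union T' c
      in if \<exists>b\<in>neighbours T' c. z = c \<inter> b
         then pmf_of_set (Pow (c - z) - {{}})
         else pmf_of_set (Pow (c - z)))"

text \<open>Families are indexed by the nodes \<open>c\<close> of the nonempty subtree \<open>T'\<close> themselves: \<open>d c\<close> is the
  chosen subset of \<open>c\<close>, \<open>n c\<close> the set of neighbours moved from \<open>c\<close> to \<open>dp c\<close>.\<close>

definition expanded_tree ::
  "'v \<Rightarrow> 'v set graph \<Rightarrow> 'v set graph \<Rightarrow> ('v set \<Rightarrow> 'v set) \<Rightarrow> ('v set \<Rightarrow> 'v set set) \<Rightarrow> 'v set graph"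
where
  "expanded_tree x T T' d n =
     (let V' = verts T'; dp = (\<lambda>c. insert x (d c))
      in ((verts T - {c \<in> V'. d c = c}) \<union> dp ` V',
          {e \<in> edges T. e \<inter> V' = {}} \<union>
          {{dp c, dp b} | c b. {c, b} \<in> edges T'} \<union>
          {{c, dp c} | c. c \<in> V' \<and> d c \<noteq> c} \<union>
          {{dp c, a} | c a. c \<in> V' \<and> a \<in> neighbours T c - V' \<and> (d c = c \<or> a \<in> n c)} \<union>
          {{c, a} | c a. c \<in> V' \<and> a \<in> neighbours T c - V' \<and> d c \<noteq> c \<and> a \<notin> n c}))"

definition expand_nonempty :: "'v \<Rightarrow> 'v set graph \<Rightarrow> 'v set graph \<Rightarrow> 'v set graph pmf" where
  "expand_nonempty x T T' =
     do {
       q \<leftarrow> Pi_pmf (verts T') {} (draw_q T');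
       let d = (\<lambda>c. separator_union T' c \<union> q c);
       n \<leftarrow> Pi_pmf (verts T') {} (\<lambda>c.
              if d c = c then return_pmf {}
              else pmf_of_set (Pow {b \<in> neighbours T c - verts T'. b \<inter> c \<subseteq> d c}));
       return_pmf (expanded_tree x T T' d n)
     }"

definition expand_along :: "'v \<Rightarrow> 'v set graph \<Rightarrow> 'v set graph \<Rightarrow> 'v set graph pmf" where
  "expand_along x T T' = (if T' = ({}, {}) then expand_empty x T else expand_nonempty x T T')"

text \<open>Law of total probability over the random subtree.\<close>

definition expander_prob ::
  "(nat \<Rightarrow> 'v) \<Rightarrow> real \<Rightarrow> real \<Rightarrow> nat \<Rightarrow> 'v set graph \<Rightarrow> 'v set graph \<Rightarrow> real" where
  "expander_prob y \<alpha> \<beta> m T T_plus =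
     (\<Sum>T' | is_subtree T' T. subtree_kernel \<alpha> \<beta> T T' * pmf (expand_along (y (m + 1)) T T') T_plus)"


section \<open>Collapser\<close>

text \<open>\<open>r\<close> maps each node containing \<open>x\<close> to its replacement.\<close>

definition collapsed_tree :: "'v \<Rightarrow> 'v set graph \<Rightarrow> ('v set \<Rightarrow> 'v set) \<Rightarrow> 'v set graph" where
  "collapsed_tree x T_plus r =
     (let \<rho> = (\<lambda>a. if x \<in> a then r a else a)
      in (\<rho> ` verts T_plus,
          (\<lambda>e. \<rho> ` e) ` {e \<in> edges T_plus. \<not> (\<exists>d\<in>verts T_plus. x \<in> d \<and> e = {d, r d})}))"

definition collapse :: "'v \<Rightarrow> 'v set graph \<Rightarrow> 'v set graph pmf" where
  "collapse x T_plus =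
     (if {x} \<in> verts T_plus
      then pmf_of_set (tree_completions (induced T_plus (verts T_plus - {{x}})))
      else do {
        r \<leftarrow> Pi_pmf {d \<in> verts T_plus. x \<in> d} {} (\<lambda>d.
               let M = {c \<in> neighbours T_plus d. c \<inter> d = d - {x}}
               in if M = {} then return_pmf (d - {x}) else pmf_of_set M);
        return_pmf (collapsed_tree x T_plus r)
      })"

definition collapser_prob ::
  "(nat \<Rightarrow> 'v) \<Rightarrow> nat \<Rightarrow> 'v set graph \<Rightarrow> 'v set graph \<Rightarrow> real" where
  "collapser_prob y m T_plus T = pmf (collapse (y (m + 1)) T_plus) T"

end

theory Submission
  imports Defs
begin

text \<open>
  A graph is a tree iff it is connected and every edge is a bridge, and a tree on the cliques has the
  junction tree property iff for every vertex the nodes containing it are connected among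
  themselves. Both conditions survive the contraction of a matching. Collapsing is such a
  contraction: each node \<open>d\<close> containing the last vertex \<open>x\<close> is identified with its replacement
  \<open>r d\<close> (an adjacent node, or a new one), and \<open>r\<close> is injective because two nodes containing \<open>x\<close>
  have no common neighbour avoiding \<open>x\<close>. The expander undoes the collapse along the subtree
  with nodes \<open>r d\<close>: separators between nodes of that subtree are those between the original nodes
  with \<open>x\<close> removed, so it may draw \<open>d - {x}\<close> for each \<open>r d\<close> and move back exactly the
  former neighbours of \<open>d\<close>.
\<close>

section \<open>Trees via bridges\<close>

text \<open>Connectivity is reachability in a bare edge set because walks, unlike simple paths, have
  images under maps that are not injective. Bridges replace cycles because bypassing an edge lifts
  along a contraction, whereas a cycle need not lift to a cycle. The overview describes the case of
  a nonempty subtree. The other case is that \<open>{x}\<close> is itself a node. Two remaining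
  nodes that share a vertex are then already connected in the remaining forest, so every link that
  the collapser adds has empty separator. With the empty subtree the expander deletes these links
  again; what is left lies inside the original tree, which is therefore one of the completions it
  may draw. In the nonempty case the draws of the expander restrict the reversal most at one point:
  some draws must be nonempty. An empty one would put one clique inside another.\<close>

definition conn :: "'a set set \<Rightarrow> 'a \<Rightarrow> 'a \<Rightarrow> bool" where
  "conn E = (\<lambda>a b. {a, b} \<in> E)\<^sup>*\<^sup>*"

lemma conn_refl [simp]: "conn E u u"
  by (simp add: conn_def)

lemma conn_edge: "{u, v} \<in> E \<Longrightarrow> conn E u v"
  by (auto simp: conn_def)

lemma conn_trans: "conn E u v \<Longrightarrow> conn E v w \<Longrightarrow> conn E u w"
  by (auto simp: conn_def)

lemma conn_sym: "conn E u v \<Longrightarrow> conn E v u"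
proof -
  have "symp (\<lambda>a b. {a, b} \<in> E)"
    by (auto simp: symp_def insert_commute)
  then show "conn E u v \<Longrightarrow> conn E v u"
    unfolding conn_def by (meson symp_rtranclp sympD)
qed

lemma conn_mono: "conn E u v \<Longrightarrow> E \<subseteq> E' \<Longrightarrow> conn E' u v"
  unfolding conn_def by (erule rtranclp_mono[THEN predicate2D, rotated]) auto

lemma conn_induct [consumes 1, case_names refl step]:
  assumes "conn E u v" "P u" "\<And>a b. conn E u a \<Longrightarrow> {a, b} \<in> E \<Longrightarrow> P a \<Longrightarrow> P b"
  shows "P v"
  using assms(1) unfolding conn_def
  by (induction rule: rtranclp_induct) (use assms in \<open>auto simp: conn_def\<close>)

text \<open>\<open>f\<close> may merge vertices: an edge only has to go to a connected pair, which
  makes the lemma fit contractions.\<close>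

lemma conn_image:
  assumes "conn E u v" "\<And>a b. {a, b} \<in> E \<Longrightarrow> conn E' (f a) (f b)"
  shows "conn E' (f u) (f v)"
  using assms(1) by (induction rule: conn_induct) (auto intro: conn_trans assms(2))

section \<open>Walks and simple paths in finite graphs\<close>

lemma simple_graphD:
  assumes "simple_graph G" "{u, v} \<in> edges G"
  shows "u \<in> verts G" "v \<in> verts G" "u \<noteq> v"
  using assms unfolding simple_graph_def by (fastforce simp: card_insert_if)+

lemma simple_graph_edgeE:
  assumes "simple_graph G" "e \<in> edges G"
  obtains u v where "e = {u, v}" "u \<noteq> v" "u \<in> verts G" "v \<in> verts G"
  using assms unfolding simple_graph_def by (metis card_2_iff insert_subset)

lemma simple_graphI:
  assumes "finite (verts G)"
    "\<And>e. e \<in> edges G \<Longrightarrow> \<exists>u v. e = {u, v} \<and> u \<noteq> v \<and> u \<in> verts G \<and> v \<in> verts G"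
  shows "simple_graph G"
  unfolding simple_graph_def using assms by fastforce

lemma successively_conn:
  assumes "successively (\<lambda>a b. {a, b} \<in> E) p" "p \<noteq> []"
  shows "conn E (hd p) (last p)"
  using assms
  by (induction p rule: induct_list012) (auto intro: conn_trans conn_edge)

lemma graph_path_conn: "graph_path G u p v \<Longrightarrow> conn (edges G) u v"
  using successively_conn unfolding graph_path_def by metis

lemma conn_graph_path:
  assumes "conn E u v" "E \<subseteq> edges G" "simple_graph G" "u \<in> verts G"
  shows "\<exists>p. graph_path (verts G, E) u p v"
  using assms(1)
proof (induction rule: conn_induct)
  case refl
  show ?case
    by (rule exI[of _ "[u]"]) (use assms in \<open>auto simp: graph_path_def\<close>)
next
  case (step a b)
  then obtain p where p: "graph_path (verts G, E) u p a" by blast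
  have b: "b \<in> verts G"
    using step assms by (meson simple_graphD(2) subsetD)
  show ?case
  proof (cases "b \<in> set p")
    case True
    \<comment> \<open>If the walk returns to the path, the path is cut at that vertex, which keeps
      it distinct.\<close>
    then obtain p1 p2 where "p = p1 @ b # p2" by (meson split_list)
    then have "graph_path (verts G, E) u (p1 @ [b]) b"
      using p by (auto simp: graph_path_def successively_append_iff hd_append split: if_splits)
    then show ?thesis by blast
  next
    case False
    then have "graph_path (verts G, E) u (p @ [b]) b"
      using p b step(2) by (auto simp: graph_path_def successively_append_iff)
    then show ?thesis by blast
  qed
qed

lemma graph_connected_iff:
  assumes "simple_graph G"
  shows "graph_connected G \<longleftrightarrow> (\<forall>u\<in>verts G. \<forall>v\<in>verts G. conn (edges G) u v)"
  unfolding graph_connected_def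
  using conn_graph_path[OF _ subset_refl assms] graph_path_conn by (metis prod.collapse)

text \<open>The closing edge of a cycle is bypassed by the rest of the cycle. Conversely a path
  between \<open>u\<close> and \<open>v\<close> that avoids the edge \<open>{u, v}\<close> closes to
  a cycle through it.\<close>

lemma graph_cycle_iff_non_bridge:
  assumes G: "simple_graph G"
  shows "(\<exists>p. graph_cycle G p) \<longleftrightarrow> (\<exists>u v. {u, v} \<in> edges G \<and> conn (edges G - {{u, v}}) u v)"
proof
  assume "\<exists>p. graph_cycle G p"
  then obtain p where p: "3 \<le> length p" "graph_path G (hd p) p (last p)" "{last p, hd p} \<in> edges G"
    by (auto simp: graph_cycle_def)
  then obtain a b c q where pq: "p = a # b # c # q"
    by (metis Suc_le_length_iff numeral_3_eq_3)
  let ?l = "last p"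
  have l: "?l \<in> set (c # q)" using pq by simp
  have "conn (edges G - {{a, ?l}}) b ?l"
  proof -
    have ne: "{u, v} \<noteq> {a, ?l}" if "u \<in> set (b # c # q)" "v \<in> set (b # c # q)" for u v
      using that p pq by (auto simp: graph_path_def doubleton_eq_iff)
    have "successively (\<lambda>u v. {u, v} \<in> edges G) (b # c # q)"
      using p pq by (simp add: graph_path_def)
    then have "successively (\<lambda>u v. {u, v} \<in> edges G - {{a, ?l}}) (b # c # q)"
      by (rule successively_mono) (use ne in auto)
    from successively_conn[OF this] show ?thesis using pq by simp
  qed
  moreover have "{a, b} \<in> edges G - {{a, ?l}}"
    using p l pq by (auto simp: graph_path_def doubleton_eq_iff)
  ultimately have "conn (edges G - {{a, ?l}}) a ?l"
    by (meson conn_edge conn_trans)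
  then show "\<exists>u v. {u, v} \<in> edges G \<and> conn (edges G - {{u, v}}) u v"
    using p(3) pq by (metis insert_commute list.sel(1))
next
  assume "\<exists>u v. {u, v} \<in> edges G \<and> conn (edges G - {{u, v}}) u v"
  then obtain u v where uv: "{u, v} \<in> edges G" "conn (edges G - {{u, v}}) u v" by blast
  obtain p where p: "graph_path (verts G, edges G - {{u, v}}) u p v"
    using conn_graph_path[OF uv(2) _ G] simple_graphD[OF G uv(1)] by auto
  have "u \<noteq> v" using simple_graphD[OF G uv(1)] by simp
  \<comment> \<open>The path cannot use \<open>{u, v}\<close>, so its second vertex is not
    \<open>v\<close> and it has the three vertices that a cycle requires.\<close>
  then obtain b q where "p = u # b # q" "b \<noteq> v" 
    using p by (cases p; cases "tl p") (auto simp: graph_path_def split: if_splits)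
  moreover from this obtain c r where "q = c # r"
    using p by (cases q) (auto simp: graph_path_def)
  moreover have "graph_path G u p v"
    using p by (auto simp: graph_path_def elim: successively_mono)
  ultimately have "graph_cycle G p"
    using uv(1) by (auto simp: graph_cycle_def graph_path_def insert_commute)
  then show "\<exists>p. graph_cycle G p" by blast
qed

lemma is_tree_iff:
  "is_tree G \<longleftrightarrow> simple_graph G \<and> (\<forall>u\<in>verts G. \<forall>v\<in>verts G. conn (edges G) u v) \<and>
     (\<forall>u v. {u, v} \<in> edges G \<longrightarrow> \<not> conn (edges G - {{u, v}}) u v)"
  by (cases "simple_graph G") (simp_all add: is_tree_def graph_connected_iff graph_cycle_iff_non_bridge)

lemma tree_bridge:
  "is_tree G \<Longrightarrow> {u, v} \<in> edges G \<Longrightarrow> \<not> conn (edges G - {{u, v}}) u v"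
  by (simp add: is_tree_iff)

text \<open>Two sides of a triangle bypass the third, which would not be a bridge.\<close>

lemma tree_no_triangle:
  assumes "is_tree G" "{a, b} \<in> edges G" "{b, c} \<in> edges G" "{a, c} \<in> edges G"
  shows False
proof -
  have s: "simple_graph G" using assms(1) by (simp add: is_tree_iff)
  have "{a, b} \<in> edges G - {{a, c}}" "{b, c} \<in> edges G - {{a, c}}"
    using assms simple_graphD(3)[OF s, of a b] simple_graphD(3)[OF s, of b c]
    by (auto simp: doubleton_eq_iff)
  then have "conn (edges G - {{a, c}}) a c" by (meson conn_edge conn_trans)
  then show False using tree_bridge assms by metis
qed

text \<open>The link of \<open>p\<close> that enters \<open>b\<close> is a bridge. The pieces of
  \<open>p\<close> on its two sides avoid it, so a connection of \<open>c\<close> and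
  \<open>c'\<close> that avoids \<open>b\<close> would bypass it.\<close>

lemma tree_path_separates:
  assumes T: "is_tree T" and p: "graph_path T c p c'" and b: "b \<in> set p" "b \<noteq> c"
    and E: "E \<subseteq> edges T" "\<And>e. e \<in> E \<Longrightarrow> b \<notin> e"
  shows "\<not> conn E c c'"
proof
  assume cc: "conn E c c'"
  obtain p1 p2 where p12: "p = p1 @ b # p2" using b(1) by (meson split_list)
  have "p1 \<noteq> []" using p p12 b(2) by (auto simp: graph_path_def)
  define a where "a = last p1"
  let ?E = "edges T - {{a, b}}"
  have d: "distinct p" using p by (simp add: graph_path_def)
  have a: "a \<in> set p1" "{a, b} \<in> edges T"
    using p p12 \<open>p1 \<noteq> []\<close> by (auto simp: graph_path_def successively_append_iff a_def)
  have "successively (\<lambda>u v. {u, v} \<in> edges T) p1" "successively (\<lambda>u v. {u, v} \<in> edges T) (b # p2)"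
    using p p12 by (auto simp: graph_path_def successively_append_iff)
  moreover have "{u, v} \<noteq> {a, b}" if "{u, v} \<subseteq> set p1 \<or> {u, v} \<subseteq> set (b # p2)" for u v
  proof -
    have "b \<notin> set p1" "a \<notin> set (b # p2)" using d a(1) p12 by auto
    then show ?thesis using that by blast
  qed
  ultimately have "successively (\<lambda>u v. {u, v} \<in> ?E) p1" "successively (\<lambda>u v. {u, v} \<in> ?E) (b # p2)"
    using successively_mono[of "\<lambda>u v. {u, v} \<in> edges T" p1 "\<lambda>u v. {u, v} \<in> ?E"]
      successively_mono[of "\<lambda>u v. {u, v} \<in> edges T" "b # p2" "\<lambda>u v. {u, v} \<in> ?E"]
    by (simp_all del: successively.simps)
  then have "conn ?E (hd p1) a" "conn ?E b (last (b # p2))"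
    using successively_conn[of ?E p1] successively_conn[of ?E "b # p2"] \<open>p1 \<noteq> []\<close>
    by (simp_all only: a_def list.sel list.distinct not_False_eq_True)
  moreover have "hd p1 = c" "last (b # p2) = c'"
    using p p12 \<open>p1 \<noteq> []\<close> by (auto simp: graph_path_def)
  ultimately have ca: "conn ?E c a" and bc: "conn ?E b c'" by simp_all
  have "conn ?E c c'"
  proof (rule conn_mono[OF cc])
    show "E \<subseteq> ?E" using E by blast
  qed
  then have "conn ?E a b"
    by (rule conn_trans[OF conn_trans[OF conn_sym[OF ca]] conn_sym[OF bc]])
  then show False using tree_bridge[OF T a(2)] by simp
qed

text \<open>A walk in the contracted graph lifts to \<open>T\<close> once pieces of \<open>C\<close>
  are inserted inside the fibres. Hence an edge that could be bypassed after the contraction would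
  come from an edge of \<open>T\<close> that could be bypassed.\<close>

lemma contraction_is_tree:
  assumes T: "is_tree T" and C: "C \<subseteq> edges T"
    and edge: "\<And>u v. {u, v} \<in> edges T \<Longrightarrow> f u = f v \<longleftrightarrow> {u, v} \<in> C"
    and fibre: "\<And>u v. u \<in> verts T \<Longrightarrow> v \<in> verts T \<Longrightarrow> f u = f v \<Longrightarrow> conn C u v"
  shows "is_tree (f ` verts T, (\<lambda>e. f ` e) ` (edges T - C))" (is "is_tree (?V, ?E)")
proof -
  have s: "simple_graph T" using T by (simp add: is_tree_iff)
  have "simple_graph (?V, ?E)"
  proof (rule simple_graphI, goal_cases)
    case 1 then show ?case using s by (simp add: simple_graph_def)
  next
    case (2 e)
    then obtain e' where e': "e = f ` e'" "e' \<in> edges T" "e' \<notin> C" by auto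
    then obtain u v where uv: "e' = {u, v}" "u \<in> verts T" "v \<in> verts T"
      using s by (metis simple_graph_edgeE)
    then show ?case using e' edge by (intro exI[of _ "f u"] exI[of _ "f v"]) auto
  qed
  moreover have "conn ?E a b" if ab: "a \<in> ?V" "b \<in> ?V" for a b
  proof -
    obtain u v where uv: "a = f u" "b = f v" "u \<in> verts T" "v \<in> verts T" using ab by auto
    have "conn (edges T) u v" using T uv by (simp add: is_tree_iff)
    then show ?thesis unfolding uv
    proof (rule conn_image)
      fix a b assume ab: "{a, b} \<in> edges T"
      show "conn ?E (f a) (f b)"
      proof (cases "{a, b} \<in> C")
        case True
        then have "f a = f b" using edge[OF ab] by blast
        then show ?thesis by simp
      next
        case False
        then have "f ` {a, b} \<in> ?E" using ab by blast
        then show ?thesis by (simp add: conn_edge)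
      qed
    qed
  qed
  moreover have "\<not> conn (?E - {{a, b}}) a b" if ab: "{a, b} \<in> ?E" for a b
  proof
    assume *: "conn (?E - {{a, b}}) a b"
    obtain e where e: "e \<in> edges T" "e \<notin> C" "{a, b} = f ` e" using ab by auto
    obtain u v where uv: "e = {u, v}" "f u = a" "f v = b"
    proof -
      obtain u v where "e = {u, v}" using e s by (metis simple_graph_edgeE)
      moreover have "f u = a \<and> f v = b \<or> f v = a \<and> f u = b"
        using e(3) unfolding \<open>e = {u, v}\<close> by (auto simp: doubleton_eq_iff)
      ultimately show thesis using that by (metis insert_commute)
    qed
    have V: "u \<in> verts T" "v \<in> verts T" using e uv simple_graphD[OF s] by auto
    have lift: "conn (edges T - {e}) w w'" if "w \<in> verts T" "w' \<in> verts T" "f w = f w'" for w w'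
      using fibre[OF that] by (rule conn_mono) (use C e in auto)
    \<comment> \<open>The claim covers the whole fibre over the current point, since the next edge
      may start at any node of that fibre.\<close>
    have "\<forall>w\<in>verts T. f w = b \<longrightarrow> conn (edges T - {e}) u w"
      using *
    proof (induction rule: conn_induct)
      case refl
      then show ?case using lift V uv by metis
    next
      case (step w1 w2)
      then obtain e' where e': "e' \<in> edges T" "e' \<notin> C" "{w1, w2} = f ` e'" by auto
      obtain g h where gh: "e' = {g, h}" "f g = w1" "f h = w2"
      proof -
        obtain g h where "e' = {g, h}" using e' s by (metis simple_graph_edgeE)
        moreover have "f g = w1 \<and> f h = w2 \<or> f h = w1 \<and> f g = w2"
          using e'(3) unfolding \<open>e' = {g, h}\<close> by (auto simp: doubleton_eq_iff)
        ultimately show thesis using that by (metis insert_commute)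
      qed
      have V': "g \<in> verts T" "h \<in> verts T" using e' gh simple_graphD[OF s] by auto
      have "e' \<noteq> e" using step(2) e e' by auto
      then have "conn (edges T - {e}) g h" using e' gh by (intro conn_edge) auto
      moreover have "conn (edges T - {e}) u g" using step V' gh by blast
      ultimately show ?case using lift V' gh conn_trans by metis
    qed
    then have "conn (edges T - {e}) u v" using V uv by blast
    then show False using tree_bridge[OF T] e uv by blast
  qed
  ultimately show ?thesis unfolding is_tree_iff fst_conv snd_conv by (intro conjI ballI allI impI)
qed

text \<open>The support of \<open>pmf_of_set\<close> is the given set if that set is finite and
  nonempty; this is the first of the two conditions.\<close>

lemma finite_tree_completions:
  assumes "finite (verts F)"
  shows "finite (tree_completions F)"
proof (rule finite_subset)
  show "tree_completions F \<subseteq> {verts F} \<times> Pow (Pow (verts F))"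
  proof
    fix T assume "T \<in> tree_completions F"
    then have "simple_graph T" "verts T = verts F"
      by (simp_all add: tree_completions_def is_tree_def)
    then show "T \<in> {verts F} \<times> Pow (Pow (verts F))"
      by (cases T) (auto simp: simple_graph_def)
  qed
qed (use assms in auto)


section \<open>Junction trees\<close>

text \<open>For trees an equivalent of the junction tree property. It speaks of connectivity instead
  of unique paths, so it passes to images and makes sense for forests too.\<close>

definition vconn :: "'v set graph \<Rightarrow> bool" where
  "vconn T \<longleftrightarrow> (\<forall>v. \<forall>c\<in>verts T. \<forall>c'\<in>verts T. v \<in> c \<longrightarrow> v \<in> c' \<longrightarrow>
     conn {e \<in> edges T. \<forall>b\<in>e. v \<in> b} c c')"

text \<open>A node on the path that lacks \<open>v\<close> would separate the two ends, so they
  could not be connected through nodes containing \<open>v\<close>. Conversely the path itself is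
  such a connection.\<close>

lemma junction_tree_of_iff:
  "junction_tree_of G T \<longleftrightarrow> is_tree T \<and> verts T = cliques G \<and> vconn T"
proof (cases "is_tree T")
  case T: True
  have s: "simple_graph T" using T by (simp add: is_tree_iff)
  have "vconn T \<longleftrightarrow> (\<forall>c\<in>verts T. \<forall>c'\<in>verts T. \<forall>p. graph_path T c p c' \<longrightarrow> (\<forall>b\<in>set p. c \<inter> c' \<subseteq> b))"
    (is "_ \<longleftrightarrow> ?J")
  proof
    assume v: "vconn T"
    show ?J
    proof (intro ballI allI impI subsetI)
      fix c c' p b v
      assume *: "c \<in> verts T" "c' \<in> verts T" "graph_path T c p c'" "b \<in> set p" "v \<in> c \<inter> c'"
      then have cc: "conn {e \<in> edges T. \<forall>b\<in>e. v \<in> b} c c'"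
        using v[unfolded vconn_def] by (meson IntD1 IntD2)
      show "v \<in> b"
      proof (rule ccontr)
        assume "v \<notin> b"
        then have "b \<noteq> c" using *(5) by auto
        have "\<not> conn {e \<in> edges T. \<forall>b\<in>e. v \<in> b} c c'"
          by (rule tree_path_separates[OF T *(3,4) \<open>b \<noteq> c\<close>]) (use \<open>v \<notin> b\<close> in auto)
        then show False using cc by contradiction
      qed
    qed
  next
    assume J: ?J
    show "vconn T"
      unfolding vconn_def
    proof (intro allI ballI impI)
      fix v c c'
      assume *: "c \<in> verts T" "c' \<in> verts T" "v \<in> c" "v \<in> c'"
      have "graph_connected T" using T by (simp add: is_tree_def)
      then obtain p where p: "graph_path T c p c'"
        using *(1,2) unfolding graph_connected_def by meson
      have "\<forall>b\<in>set p. v \<in> b"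
        using J[rule_format, OF *(1,2) p] *(3,4) by blast
      moreover have "successively (\<lambda>a b. {a, b} \<in> edges T) p"
        using p by (simp add: graph_path_def)
      ultimately have "successively (\<lambda>a b. {a, b} \<in> {e \<in> edges T. \<forall>b\<in>e. v \<in> b}) p"
        by (rule_tac successively_mono) auto
      moreover have "p \<noteq> []" "hd p = c" "last p = c'" using p by (simp_all add: graph_path_def)
      ultimately show "conn {e \<in> edges T. \<forall>b\<in>e. v \<in> b} c c'"
        using successively_conn by blast
    qed
  qed
  with T show ?thesis by (simp only: junction_tree_of_def)
qed (simp add: junction_tree_of_def)

section \<open>Cliques, vertex deletion and the graph recovered from its cliques\<close>

lemma complete_in_extends:
  assumes "finite (verts G)" "complete_in G W"
  obtains W' where "W' \<in> cliques G" "W \<subseteq> W'"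
proof -
  let ?S = "{W'. complete_in G W' \<and> W \<subseteq> W'}"
  have "finite ?S"
    by (rule finite_subset[of _ "Pow (verts G)"]) (use assms in \<open>auto simp: complete_in_def\<close>)
  moreover have "W \<in> ?S" using assms by auto
  ultimately obtain W' where W': "W' \<in> ?S" "\<And>X. X \<in> ?S \<Longrightarrow> W' \<subseteq> X \<Longrightarrow> W' = X"
    using finite_has_maximal[of ?S] by (metis empty_iff)
  have "W' \<in> cliques G"
    unfolding cliques_def
  proof (intro CollectI conjI allI impI)
    show "complete_in G W'" using W'(1) by simp
    fix X assume "complete_in G X \<and> W' \<subseteq> X"
    then show "X = W'" using W'(1) W'(2)[of X] by blast
  qed
  then show thesis using that W'(1) by simp
qed

lemma cliques_antichain: "c \<in> cliques G \<Longrightarrow> c' \<in> cliques G \<Longrightarrow> c \<subseteq> c' \<Longrightarrow> c = c'"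
  unfolding cliques_def by blast

lemma cliques_complete: "c \<in> cliques G \<Longrightarrow> complete_in G c"
  by (simp add: cliques_def)

lemma clique_nonempty:
  assumes "verts G \<noteq> {}" "c \<in> cliques G"
  shows "c \<noteq> {}"
proof
  assume "c = {}"
  obtain v where "v \<in> verts G" using assms by blast
  then have "complete_in G {v}" by (auto simp: complete_in_def)
  then have "{v} = c" using assms(2) \<open>c = {}\<close> unfolding cliques_def by blast
  then show False using \<open>c = {}\<close> by simp
qed

lemma complete_in_induced_iff:
  "complete_in (induced G A) W \<longleftrightarrow> complete_in G W \<and> W \<subseteq> A"
  by (auto simp: complete_in_def induced_def)

lemma complete_in_remove_iff:
  "complete_in (induced G (verts G - {x})) W \<longleftrightarrow> complete_in G W \<and> x \<notin> W"
proof -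
  have "W \<subseteq> verts G" if "complete_in G W" using that by (simp add: complete_in_def)
  then show ?thesis unfolding complete_in_induced_iff by blast
qed

text \<open>Every vertex and every edge is a complete set and so extends to a clique. Once the nodes
  of the collapsed tree are known to be the right cliques, the claim on underlying graphs
  follows.\<close>

lemma underlying_graph_of_cliques:
  assumes "simple_graph G" "verts T = cliques G"
  shows "underlying_graph T = G"
proof -
  have fin: "finite (verts G)" using assms(1) by (simp add: simple_graph_def)
  have "verts G \<subseteq> \<Union>(cliques G)"
  proof
    fix v assume "v \<in> verts G"
    then have "complete_in G {v}" by (auto simp: complete_in_def)
    then show "v \<in> \<Union>(cliques G)" using complete_in_extends[OF fin] by blast
  qed
  moreover have "c \<subseteq> verts G" if "c \<in> cliques G" for c
    using cliques_complete[OF that] by (simp add: complete_in_def)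
  ultimately have "\<Union>(cliques G) = verts G" by blast
  moreover have "{{u, v} | u v. u \<noteq> v \<and> (\<exists>c\<in>cliques G. u \<in> c \<and> v \<in> c)} = edges G" (is "?L = _")
  proof
    show "?L \<subseteq> edges G"
    proof
      fix e assume "e \<in> ?L"
      then obtain u v c where "e = {u, v}" "u \<noteq> v" "c \<in> cliques G" "u \<in> c" "v \<in> c" by blast
      then show "e \<in> edges G" using cliques_complete[of c G] by (simp add: complete_in_def)
    qed
  next
    show "edges G \<subseteq> ?L"
    proof
      fix e assume e: "e \<in> edges G"
      then obtain u v where uv: "e = {u, v}" "u \<noteq> v" "u \<in> verts G" "v \<in> verts G"
        using assms(1) by (metis simple_graph_edgeE)
      then have "complete_in G {u, v}" using e by (auto simp: complete_in_def insert_commute)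
      then obtain c where "c \<in> cliques G" "{u, v} \<subseteq> c" using complete_in_extends[OF fin] by blast
      then show "e \<in> ?L" using uv by blast
    qed
  qed
  ultimately show ?thesis using assms(2) by (simp add: underlying_graph_def prod_eq_iff)
qed

lemma simple_graph_induced: "simple_graph G \<Longrightarrow> simple_graph (induced G A)"
  by (auto simp: simple_graph_def induced_def)




section \<open>Transport of the junction property, and its use on short paths\<close>

lemma vconn_mono:
  assumes "vconn F" "verts T = verts F" "edges F \<subseteq> edges T"
  shows "vconn T"
  unfolding vconn_def
proof (intro allI ballI impI)
  fix v c c'
  assume "c \<in> verts T" "c' \<in> verts T" "v \<in> c" "v \<in> c'"
  then have "conn {e \<in> edges F. \<forall>b\<in>e. v \<in> b} c c'"
    using assms(1,2) by (simp only: vconn_def)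
  then show "conn {e \<in> edges T. \<forall>b\<in>e. v \<in> b} c c'"
    by (rule conn_mono) (use assms(3) in blast)
qed

text \<open>\<open>lift\<close> provides preimages that contain \<open>v\<close> themselves: an
  image may be larger than the node it replaces, so an arbitrary preimage need not contain
  \<open>v\<close>. For \<open>x\<close> there is nothing to connect, as no image contains
  it.\<close>

lemma vconn_image:
  assumes T: "vconn T" "simple_graph T"
    and keep: "\<And>c v. c \<in> verts T \<Longrightarrow> v \<in> c \<Longrightarrow> v \<noteq> x \<Longrightarrow> v \<in> f c"
    and x: "\<And>c. c \<in> verts T \<Longrightarrow> x \<notin> f c"
    and lift: "\<And>c v. c \<in> verts T \<Longrightarrow> v \<in> f c \<Longrightarrow> \<exists>c'\<in>verts T. f c' = f c \<and> v \<in> c'"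
    and edge: "\<And>u v. {u, v} \<in> edges T \<Longrightarrow> f u \<noteq> f v \<Longrightarrow> {f u, f v} \<in> E"
  shows "vconn (f ` verts T, E)"
  unfolding vconn_def fst_conv snd_conv
proof (intro allI ballI impI)
  fix v c c'
  assume *: "c \<in> f ` verts T" "c' \<in> f ` verts T" "v \<in> c" "v \<in> c'"
  obtain u where u: "u \<in> verts T" "f u = c" "v \<in> u" using * lift by blast
  obtain u' where u': "u' \<in> verts T" "f u' = c'" "v \<in> u'" using * lift by blast
  have "v \<noteq> x" using x[OF u(1)] u(2) *(3) by blast
  have "conn {e \<in> edges T. \<forall>b\<in>e. v \<in> b} u u'"
    using T(1) u u' unfolding vconn_def by blast
  then have "conn {e \<in> E. \<forall>b\<in>e. v \<in> b} (f u) (f u')"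
  proof (rule conn_image)
    fix a b
    assume "{a, b} \<in> {e \<in> edges T. \<forall>b\<in>e. v \<in> b}"
    then have ab: "{a, b} \<in> edges T" "v \<in> a" "v \<in> b" by simp_all
    then have "v \<in> f a" "v \<in> f b"
      using keep \<open>v \<noteq> x\<close> simple_graphD[OF T(2) ab(1)] by simp_all
    then show "conn {e \<in> E. \<forall>b\<in>e. v \<in> b} (f a) (f b)"
      using edge[OF ab(1)] by (cases "f a = f b") (simp_all add: conn_edge)
  qed
  then show "conn {e \<in> E. \<forall>b\<in>e. v \<in> b} c c'" by (simp only: u u')
qed

text \<open>Turns an inclusion in a remote clique into one in a neighbour of \<open>d\<close>: the
  first link on the way to \<open>a\<close> already carries the intersection.\<close>

lemma tree_first_link:
  assumes jt: "junction_tree_of G T" and "a \<in> verts T" "d \<in> verts T" "a \<noteq> d"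
  obtains b where "{b, d} \<in> edges T" "a \<inter> d \<subseteq> b"
proof -
  have "graph_connected T" using jt by (simp add: junction_tree_of_def is_tree_def)
  then obtain p where p: "graph_path T d p a"
    using assms(2,3) unfolding graph_connected_def by meson
  then obtain b q where q: "p = d # b # q"
    using \<open>a \<noteq> d\<close> by (cases p; cases "tl p") (auto simp: graph_path_def)
  have "d \<inter> a \<subseteq> b"
    using jt p assms(2,3) q unfolding junction_tree_of_def by (meson list.set_intros)
  moreover have "{d, b} \<in> edges T" using p q by (simp add: graph_path_def)
  ultimately show thesis using that by (simp add: insert_commute inf_commute)
qed

lemma junction_path3:
  assumes jt: "junction_tree_of G T" and E: "{a, b} \<in> edges T" "{b, c} \<in> edges T" and "a \<noteq> c"
  shows "a \<inter> c \<subseteq> b"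
proof -
  have s: "simple_graph T" using jt by (simp add: junction_tree_of_iff is_tree_iff)
  note V = simple_graphD[OF s E(1)] simple_graphD[OF s E(2)]
  have "graph_path T a [a, b, c] c" using V E \<open>a \<noteq> c\<close> by (simp add: graph_path_def)
  then have "\<forall>b'\<in>set [a, b, c]. a \<inter> c \<subseteq> b'"
    using jt V unfolding junction_tree_of_def by blast
  then show ?thesis by simp
qed

lemma junction_path4:
  assumes jt: "junction_tree_of G T"
    and E: "{a, b} \<in> edges T" "{b, c} \<in> edges T" "{c, d} \<in> edges T" and "a \<noteq> c" "b \<noteq> d"
  shows "a \<inter> d \<subseteq> b" "a \<inter> d \<subseteq> c"
proof -
  have t: "is_tree T" using jt by (simp add: junction_tree_of_iff)
  then have s: "simple_graph T" by (simp add: is_tree_iff)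
  note V = simple_graphD[OF s E(1)] simple_graphD[OF s E(2)] simple_graphD[OF s E(3)]
  \<comment> \<open>With \<open>a = d\<close> the three links would form a triangle.\<close>
  have "a \<noteq> d" using tree_no_triangle[OF t E(1,2)] E(3) by (auto simp: insert_commute)
  then have "graph_path T a [a, b, c, d] d"
    using V E \<open>a \<noteq> c\<close> \<open>b \<noteq> d\<close> by (simp add: graph_path_def)
  then have "\<forall>b'\<in>set [a, b, c, d]. a \<inter> d \<subseteq> b'"
    using jt V unfolding junction_tree_of_def by blast
  then show "a \<inter> d \<subseteq> b" "a \<inter> d \<subseteq> c" by simp_all
qed


section \<open>Collapsing along a nonempty subtree\<close>

text \<open>\<open>r\<close> is one outcome of the independent draws. Only supports matter for the
  claims, so the argument runs for a fixed \<open>r\<close> and probabilities return at the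
  end.\<close>

locale collapse_choice =
  fixes G :: "'v graph" and T :: "'v set graph" and x :: 'v and r :: "'v set \<Rightarrow> 'v set"
  assumes simple: "simple_graph G"
    and jt: "junction_tree_of G T"
    and choice: "\<And>d. d \<in> verts T \<Longrightarrow> x \<in> d \<Longrightarrow>
      (if {c \<in> neighbours T d. c \<inter> d = d - {x}} = {} then r d = d - {x}
       else r d \<in> {c \<in> neighbours T d. c \<inter> d = d - {x}})"
begin

definition \<rho> :: "'v set \<Rightarrow> 'v set" where "\<rho> a = (if x \<in> a then r a else a)"

definition P :: "'v set set" where "P = {d \<in> verts T. x \<in> d}"

text \<open>The links to be contracted. They form a matching, since \<open>r\<close> is injective on
  \<open>P\<close> and its values lie outside \<open>P\<close>.\<close>

definition C :: "'v set set set" where "C = {e \<in> edges T. \<exists>d\<in>verts T. x \<in> d \<and> e = {d, r d}}"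

abbreviation Tc :: "'v set graph" where "Tc \<equiv> collapsed_tree x T r"

lemma tree: "is_tree T" and verts_eq: "verts T = cliques G" and vconn: "vconn T"
  using jt by (simp_all add: junction_tree_of_iff)

lemma simple_T: "simple_graph T"
  using tree by (simp add: is_tree_iff)

lemma Tc_eq: "Tc = (\<rho> ` verts T, (\<lambda>e. \<rho> ` e) ` (edges T - C))"
proof -
  have "{e \<in> edges T. \<not> (\<exists>d\<in>verts T. x \<in> d \<and> e = {d, r d})} = edges T - C"
    unfolding C_def by blast
  moreover have "(\<lambda>a. if x \<in> a then r a else a) = \<rho>" by (simp add: \<rho>_def fun_eq_iff)
  ultimately show ?thesis unfolding collapsed_tree_def Let_def by (simp only:)
qed

lemma PD: "d \<in> P \<Longrightarrow> d \<in> verts T" "d \<in> P \<Longrightarrow> x \<in> d"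
  by (simp_all add: P_def)

lemma antichain: "a \<in> verts T \<Longrightarrow> b \<in> verts T \<Longrightarrow> a \<subseteq> b \<Longrightarrow> a = b"
  using cliques_antichain verts_eq by metis

lemma r_cases [consumes 1, case_names new old]:
  assumes "d \<in> P"
  obtains "r d = d - {x}" "r d \<notin> verts T" "\<And>c. {c, d} \<in> edges T \<Longrightarrow> c \<inter> d \<noteq> d - {x}"
  | "r d \<in> verts T" "{r d, d} \<in> edges T" "r d \<inter> d = d - {x}"
proof (cases "{c \<in> neighbours T d. c \<inter> d = d - {x}} = {}")
  case True
  then have 1: "r d = d - {x}" using choice PD assms by simp
  \<comment> \<open>\<open>d - {x}\<close> lies properly inside the clique \<open>d\<close>, so it
    is not a clique itself.\<close>
  moreover have "d - {x} \<notin> verts T" using antichain[of "d - {x}" d] PD[OF assms] by blast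
  moreover have "c \<inter> d \<noteq> d - {x}" if "{c, d} \<in> edges T" for c
    using True that unfolding neighbours_def by blast
  ultimately show ?thesis using that(1) by metis
next
  case False
  then have "r d \<in> {c \<in> neighbours T d. c \<inter> d = d - {x}}"
    using choice[OF PD[OF assms]] by meson
  then have "{r d, d} \<in> edges T" "r d \<inter> d = d - {x}" by (simp_all add: neighbours_def)
  then show ?thesis using that(2) simple_graphD[OF simple_T] by metis
qed

lemma r_basic:
  assumes "d \<in> P"
  shows "d - {x} \<subseteq> r d" "x \<notin> r d" "r d \<notin> P"
proof -
  show "d - {x} \<subseteq> r d" using assms by (cases rule: r_cases) auto
  show "x \<notin> r d" using assms PD(2)[OF assms] by (cases rule: r_cases) auto
  then show "r d \<notin> P" by (simp add: P_def)
qed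

lemma r_new:
  assumes "d \<in> P" "r d \<notin> verts T"
  shows "r d = d - {x}"
  using assms by (cases rule: r_cases) auto

lemma r_old:
  assumes "d \<in> P" "r d \<in> verts T"
  shows "{r d, d} \<in> edges T" "r d \<inter> d = d - {x}"
  using assms by (cases rule: r_cases; simp)+

text \<open>On a path \<open>d\<close>, \<open>a\<close>, \<open>d'\<close> both ends contain
  \<open>x\<close>, so the middle node would contain it too.\<close>

lemma link_P:
  assumes "d \<in> P" "d' \<in> P" "{a, d} \<in> edges T" "{a, d'} \<in> edges T" "x \<notin> a"
  shows "d = d'"
  using junction_path3[OF jt, of d a d'] assms PD(2) by (auto simp: insert_commute)

text \<open>An old replacement has only one neighbour in \<open>P\<close>, by \<open>link_P\<close>;
  a new one is \<open>d - {x}\<close>, which determines \<open>d\<close>.\<close>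

lemma r_inj: "inj_on r P"
proof (rule inj_onI)
  fix d d' assume *: "d \<in> P" "d' \<in> P" "r d = r d'"
  show "d = d'"
  proof (cases "r d \<in> verts T")
    case True
    then show ?thesis
      using link_P[OF *(1,2) r_old(1)[OF *(1)]] r_old(1)[OF *(2)] r_basic(2)[OF *(1)] *(3) by simp
  next
    case False
    then have "d - {x} = d' - {x}" using r_new * by metis
    then show ?thesis using PD(2)[OF *(1)] PD(2)[OF *(2)] by blast
  qed
qed

lemma \<rho>_simps: "d \<in> P \<Longrightarrow> \<rho> d = r d" "x \<notin> a \<Longrightarrow> \<rho> a = a"
  by (simp_all add: \<rho>_def P_def)

lemma x_notin_\<rho>: "a \<in> verts T \<Longrightarrow> x \<notin> \<rho> a"
  using r_basic(2) by (auto simp: \<rho>_def P_def)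

text \<open>Nodes without \<open>x\<close> are fixed and nodes with \<open>x\<close> are told apart
  by injectivity of \<open>r\<close>, so a fibre has at most two elements.\<close>

lemma \<rho>_eq_cases:
  assumes "u \<in> verts T" "v \<in> verts T" "\<rho> u = \<rho> v"
  shows "u = v \<or> (u \<in> P \<and> v = r u) \<or> (v \<in> P \<and> u = r v)"
proof (cases "x \<in> u"; cases "x \<in> v")
  assume "x \<in> u" "x \<in> v"
  then show ?thesis using assms r_inj by (auto simp: \<rho>_def P_def inj_on_def)
qed (use assms in \<open>auto simp: \<rho>_def P_def\<close>)

lemma r_link_in_C: "d \<in> P \<Longrightarrow> r d \<in> verts T \<Longrightarrow> {d, r d} \<in> C"
  using r_old(1)[of d] by (auto simp: C_def P_def insert_commute)

lemma \<rho>_eq_iff: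
  assumes "{u, v} \<in> edges T"
  shows "\<rho> u = \<rho> v \<longleftrightarrow> {u, v} \<in> C"
proof
  note V = simple_graphD[OF simple_T assms]
  assume "\<rho> u = \<rho> v"
  with \<rho>_eq_cases[OF V(1,2)] V show "{u, v} \<in> C"
    using r_link_in_C[of u] r_link_in_C[of v] by (auto simp: insert_commute)
next
  assume "{u, v} \<in> C"
  then obtain d where d: "d \<in> P" "{u, v} = {d, r d}" by (auto simp: C_def P_def)
  have "\<rho> d = \<rho> (r d)" using d(1) r_basic(2) \<rho>_simps by metis
  then show "\<rho> u = \<rho> v" using d(2) by (auto simp: doubleton_eq_iff)
qed

lemma tree_Tc: "is_tree Tc"
  unfolding Tc_eq
proof (rule contraction_is_tree[OF tree])
  show "C \<subseteq> edges T" by (auto simp: C_def)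
  show "\<And>u v. {u, v} \<in> edges T \<Longrightarrow> \<rho> u = \<rho> v \<longleftrightarrow> {u, v} \<in> C" by (rule \<rho>_eq_iff)
  fix u v assume uv: "u \<in> verts T" "v \<in> verts T" "\<rho> u = \<rho> v"
  from \<rho>_eq_cases[OF this] uv(1,2) show "conn C u v"
    using conn_edge[OF r_link_in_C[of u]] conn_sym[OF conn_edge[OF r_link_in_C[of v]]] by auto
qed

text \<open>The condition \<open>c \<noteq> a\<close> expresses the removal of the links in
  \<open>C\<close>, and the ends come in matching order.\<close>

lemma Tc_edge_iff:
  "{c, a} \<in> edges Tc \<longleftrightarrow> (\<exists>u v. {u, v} \<in> edges T \<and> \<rho> u = c \<and> \<rho> v = a \<and> c \<noteq> a)"
proof
  assume "{c, a} \<in> edges Tc"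
  then obtain e where e: "e \<in> edges T" "e \<notin> C" "{c, a} = \<rho> ` e" by (auto simp: Tc_eq)
  then obtain u v where uv: "e = {u, v}" using simple_T by (metis simple_graph_edgeE)
  have ne: "\<rho> u \<noteq> \<rho> v" using \<rho>_eq_iff e uv by metis
  have "\<rho> u = c \<and> \<rho> v = a \<or> \<rho> v = c \<and> \<rho> u = a"
    using e(3) unfolding uv by (auto simp: doubleton_eq_iff)
  then show "\<exists>u v. {u, v} \<in> edges T \<and> \<rho> u = c \<and> \<rho> v = a \<and> c \<noteq> a"
    using ne e(1) uv by (metis insert_commute)
next
  assume "\<exists>u v. {u, v} \<in> edges T \<and> \<rho> u = c \<and> \<rho> v = a \<and> c \<noteq> a"
  then obtain u v where uv: "{u, v} \<in> edges T" "\<rho> u = c" "\<rho> v = a" "c \<noteq> a" by blast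
  then have "{u, v} \<in> edges T - C" using \<rho>_eq_iff by blast
  then have "\<rho> ` {u, v} \<in> edges Tc" unfolding Tc_eq snd_conv by (rule imageI)
  then show "{c, a} \<in> edges Tc" using uv by simp
qed

text \<open>A clique that contains \<open>x\<close> loses it and stays maximal unless another clique
  absorbs the rest. The junction tree makes this a local matter: if any clique absorbs
  \<open>d - {x}\<close>, then a neighbour of \<open>d\<close> does, and this is what the collapser
  tests.\<close>

lemma cliques_collapsed: "cliques (induced G (verts G - {x})) = \<rho> ` verts T"
proof -
  let ?G = "induced G (verts G - {x})"
  have fin: "finite (verts G)" using simple by (simp add: simple_graph_def)
  note complete = complete_in_remove_iff[of G x]
  have complete_V: "complete_in G a" if "a \<in> verts T" for a
    using that verts_eq cliques_complete by metis
  have complete_minus: "complete_in G (a - {x})" if "a \<in> verts T" for a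
    using complete_V[OF that] by (auto simp: complete_in_def)
  have extend: "\<exists>a\<in>verts T. W \<subseteq> a" if "complete_in G W" for W
    using complete_in_extends[OF fin that] verts_eq by metis
  have maximal: "W = a" if "a \<in> verts T" "complete_in G W" "a \<subseteq> W" for a W
    using extend[OF that(2)] antichain[OF that(1)] that(3) by blast
  have cliqueI: "W \<in> cliques ?G"
    if "complete_in G W" "x \<notin> W" "\<And>W'. complete_in G W' \<Longrightarrow> x \<notin> W' \<Longrightarrow> W \<subseteq> W' \<Longrightarrow> W' = W" for W
    using that by (simp add: cliques_def complete)
  show ?thesis
  proof
    show "\<rho> ` verts T \<subseteq> cliques ?G"
    proof
      fix W assume "W \<in> \<rho> ` verts T"
      then obtain u where u: "u \<in> verts T" "W = \<rho> u" by blast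
      have xW: "x \<notin> W" using x_notin_\<rho> u by blast
      show "W \<in> cliques ?G"
      proof (cases "W \<in> verts T")
        case True
        then show ?thesis using cliqueI[OF complete_V xW] maximal by blast
      next
        case False
        then have "u \<in> P" using u by (auto simp: P_def \<rho>_def split: if_splits)
        then have W: "W = u - {x}" "r u \<notin> verts T" using False u r_new \<rho>_simps by metis+
        show ?thesis
        proof (rule cliqueI[OF _ xW])
          show "complete_in G W" using complete_minus u(1) W by simp
          fix W' assume W': "complete_in G W'" "x \<notin> W'" "W \<subseteq> W'"
          obtain a where a: "a \<in> verts T" "W' \<subseteq> a" using extend[OF W'(1)] by blast
          \<comment> \<open>Another clique over \<open>u - {x}\<close> would make the neighbour of
            \<open>u\<close> in its direction meet \<open>u\<close> in exactly
            \<open>u - {x}\<close>; then \<open>r u\<close> would be an old node.\<close>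
          have "a = u"
          proof (rule ccontr)
            assume "a \<noteq> u"
            then have "\<not> u \<subseteq> a" using antichain[OF u(1) a(1)] by blast
            then have "x \<notin> a" using W'(3) a(2) W(1) by blast
            obtain b where b: "{b, u} \<in> edges T" "a \<inter> u \<subseteq> b"
              using tree_first_link[OF jt a(1) u(1) \<open>a \<noteq> u\<close>] by blast
            have "u - {x} \<subseteq> b" using b(2) W'(3) a(2) W(1) by blast
            moreover have "\<not> u \<subseteq> b"
              using antichain[OF u(1)] simple_graphD[OF simple_T b(1)] by blast
            ultimately have "b \<inter> u = u - {x}" by blast
            with \<open>u \<in> P\<close> b(1) W(2) show False by (cases rule: r_cases) blast+
          qed
          then show "W' = W" using W' a(2) W(1) by blast
        qed
      qed
    qed
  next
    show "cliques ?G \<subseteq> \<rho> ` verts T"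
    proof
      fix W assume W: "W \<in> cliques ?G"
      then have c: "complete_in G W" "x \<notin> W"
        and max: "\<And>W'. complete_in G W' \<Longrightarrow> x \<notin> W' \<Longrightarrow> W \<subseteq> W' \<Longrightarrow> W' = W"
        using complete unfolding cliques_def by blast+
      obtain a where a: "a \<in> verts T" "W \<subseteq> a" using extend[OF c(1)] by blast
      have "\<rho> a = W"
      proof (cases "x \<in> a")
        case False
        then show ?thesis using max[OF complete_V] a by (simp add: \<rho>_def)
      next
        case True
        then have "a \<in> P" using a by (simp add: P_def)
        have Wa: "a - {x} = W" using max[OF complete_minus[OF a(1)]] a(2) c(2) by blast
        have "W \<subseteq> r a" using r_basic(1)[OF \<open>a \<in> P\<close>] Wa by simp
        have "r a = W"
        proof (cases "r a \<in> verts T")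
          case True
          then show ?thesis
            using max[OF complete_V] r_basic(2)[OF \<open>a \<in> P\<close>] \<open>W \<subseteq> r a\<close> by blast
        qed (use r_new[OF \<open>a \<in> P\<close>] Wa in simp)
        then show ?thesis using \<rho>_simps \<open>a \<in> P\<close> by simp
      qed
      then show "W \<in> \<rho> ` verts T" using a(1) by blast
    qed
  qed
qed

lemma junction_tree_Tc: "junction_tree_of (induced G (verts G - {x})) Tc"
proof -
  have "vconn Tc"
    unfolding Tc_eq
  proof (rule vconn_image[OF vconn simple_T, of x])
    fix c v assume *: "c \<in> verts T" "v \<in> c" "v \<noteq> x"
    then show "v \<in> \<rho> c" using r_basic(1)[of c] by (auto simp: \<rho>_def P_def)
  next
    fix c v assume *: "c \<in> verts T" "v \<in> \<rho> c"
    show "\<exists>c'\<in>verts T. \<rho> c' = \<rho> c \<and> v \<in> c'"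
    \<comment> \<open>An image that is a node of \<open>T\<close> is its own preimage; a new one is
      \<open>c\<close> without \<open>x\<close>.\<close>
    proof (cases "\<rho> c \<in> verts T")
      case True
      then show ?thesis using * x_notin_\<rho> \<rho>_simps(2) by metis
    next
      case False
      then have "c \<in> P" using * by (auto simp: P_def \<rho>_def split: if_splits)
      then have "\<rho> c = c - {x}" using r_new False \<rho>_simps(1) by metis
      then show ?thesis using * by blast
    qed
  next
    fix u v assume "{u, v} \<in> edges T" "\<rho> u \<noteq> \<rho> v"
    then have "{u, v} \<in> edges T - C" using \<rho>_eq_iff by blast
    then have "\<rho> ` {u, v} \<in> (\<lambda>e. \<rho> ` e) ` (edges T - C)" by (rule imageI)
    then show "{\<rho> u, \<rho> v} \<in> (\<lambda>e. \<rho> ` e) ` (edges T - C)" by simp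
  qed (rule x_notin_\<rho>)
  moreover have "verts Tc = cliques (induced G (verts G - {x}))"
    by (simp add: cliques_collapsed Tc_eq)
  ultimately show ?thesis using tree_Tc by (simp only: junction_tree_of_iff)
qed


section \<open>The subtree of replacements along which the expander undoes the collapse\<close>

definition S :: "'v set graph" where
  "S = (r ` P, {{r d, r d'} | d d'. d \<in> P \<and> d' \<in> P \<and> {d, d'} \<in> edges T})"

lemma finite_P: "finite P"
  using simple_T by (simp add: P_def simple_graph_def)

lemma S_edge_iff:
  assumes "d \<in> P" "d' \<in> P"
  shows "{r d, r d'} \<in> edges S \<longleftrightarrow> {d, d'} \<in> edges T"
proof
  assume "{r d, r d'} \<in> edges S"
  then obtain e e' where e: "e \<in> P" "e' \<in> P" "{e, e'} \<in> edges T" "{r d, r d'} = {r e, r e'}"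
    by (auto simp: S_def)
  then have "r ` {d, d'} = r ` {e, e'}" by simp
  then have "{d, d'} = {e, e'}"
    using inj_on_image_eq_iff[OF r_inj, of "{d, d'}" "{e, e'}"] assms e(1,2) by simp
  then show "{d, d'} \<in> edges T" using e(3) by simp
qed (use assms in \<open>auto simp: S_def\<close>)

lemma S_edgeE:
  assumes "{c, b} \<in> edges S"
  obtains d d' where "d \<in> P" "d' \<in> P" "{d, d'} \<in> edges T" "c = r d" "b = r d'"
proof -
  obtain d d' where "d \<in> P" "d' \<in> P" "{d, d'} \<in> edges T" "{c, b} = {r d, r d'}"
    using assms by (auto simp: S_def)
  then show thesis using that[of d d'] that[of d' d] by (auto simp: doubleton_eq_iff insert_commute)
qed

lemma subtree_S: "is_subtree S Tc"
proof -
  have inj: "r d \<noteq> r d'" if "d \<in> P" "d' \<in> P" "{d, d'} \<in> edges T" for d d'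
    using simple_graphD(3)[OF simple_T that(3)] inj_onD[OF r_inj _ that(1,2)] by blast
  have simple_S: "simple_graph S"
  proof (rule simple_graphI)
    show "finite (verts S)" by (simp add: S_def finite_P)
    fix e assume "e \<in> edges S"
    then obtain d d' where "d \<in> P" "d' \<in> P" "{d, d'} \<in> edges T" "e = {r d, r d'}"
      by (auto simp: S_def)
    then show "\<exists>u v. e = {u, v} \<and> u \<noteq> v \<and> u \<in> verts S \<and> v \<in> verts S"
      using inj by (intro exI[of _ "r d"] exI[of _ "r d'"]) (simp add: S_def)
  qed
  have "verts S \<subseteq> verts Tc"
    using \<rho>_simps(1) PD(1) by (auto simp: S_def Tc_eq image_iff)
  moreover have "edges S \<subseteq> edges Tc"
  proof
    fix e assume "e \<in> edges S"
    then obtain d d' where d: "d \<in> P" "d' \<in> P" "{d, d'} \<in> edges T" "e = {r d, r d'}"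
      by (auto simp: S_def)
    then have "{r d, r d'} \<in> edges Tc"
      unfolding Tc_edge_iff using inj[OF d(1-3)] \<rho>_simps(1) by blast
    then show "e \<in> edges Tc" using d(4) by simp
  qed
  moreover have "graph_connected S"
    unfolding graph_connected_iff[OF simple_S]
  proof (intro ballI)
    fix u v assume "u \<in> verts S" "v \<in> verts S"
    then obtain d d' where d: "d \<in> P" "d' \<in> P" "u = r d" "v = r d'" by (auto simp: S_def)
    \<comment> \<open>The junction property for the vertex \<open>x\<close> itself connects the
      nodes of \<open>P\<close>.\<close>
    have "conn {e \<in> edges T. \<forall>b\<in>e. x \<in> b} d d'"
      using vconn PD[OF d(1)] PD[OF d(2)] by (simp add: vconn_def)
    then have "conn (edges S) (r d) (r d')"
    proof (rule conn_image)
      fix a b assume "{a, b} \<in> {e \<in> edges T. \<forall>b\<in>e. x \<in> b}"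
      then have ab: "{a, b} \<in> edges T" "x \<in> a" "x \<in> b" by simp_all
      then have "a \<in> P" "b \<in> P" using simple_graphD[OF simple_T ab(1)] by (simp_all add: P_def)
      then show "conn (edges S) (r a) (r b)" using ab(1) S_edge_iff conn_edge by metis
    qed
    then show "conn (edges S) u v" using d by simp
  qed
  ultimately show ?thesis using simple_S by (simp add: is_subtree_def)
qed

text \<open>If both replacements are old, then \<open>r d\<close>, \<open>d\<close>,
  \<open>d'\<close>, \<open>r d'\<close> is a path of \<open>T\<close>, so what its ends share lies
  in \<open>d\<close> and \<open>d'\<close>. A new replacement is part of its node, which shortens
  the path.\<close>

lemma separator_S:
  assumes d: "d \<in> P" "d' \<in> P" "{d, d'} \<in> edges T"
  shows "r d \<inter> r d' = d \<inter> d' - {x}"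
proof
  show "d \<inter> d' - {x} \<subseteq> r d \<inter> r d'" using r_basic(1) d by blast
next
  have d': "{d', d} \<in> edges T" using d(3) by (simp add: insert_commute)
  have ne: "r d \<noteq> d'" "r d' \<noteq> d" using r_basic(3) d by blast+
  have "r d \<inter> r d' \<subseteq> d \<inter> d'"
  proof (cases "r d \<in> verts T"; cases "r d' \<in> verts T")
    assume V: "r d \<in> verts T" "r d' \<in> verts T"
    have "{d', r d'} \<in> edges T" using r_old(1)[OF d(2) V(2)] by (simp add: insert_commute)
    from junction_path4[OF jt r_old(1)[OF d(1) V(1)] d(3) this ne(1) ne(2)[symmetric]]
    show ?thesis by blast
  next
    assume V: "r d \<in> verts T" "r d' \<notin> verts T"
    show ?thesis
      using junction_path3[OF jt r_old(1)[OF d(1) V(1)] d(3) ne(1)] r_new[OF d(2) V(2)] by blast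
  next
    assume V: "r d \<notin> verts T" "r d' \<in> verts T"
    show ?thesis
      using junction_path3[OF jt r_old(1)[OF d(2) V(2)] d' ne(2)] r_new[OF d(1) V(1)] by blast
  next
    assume V: "r d \<notin> verts T" "r d' \<notin> verts T"
    then show ?thesis using r_new d by blast
  qed
  then show "r d \<inter> r d' \<subseteq> d \<inter> d' - {x}" using r_basic(2)[OF d(1)] by blast
qed

lemma neighbours_S:
  assumes "d \<in> P"
  shows "neighbours S (r d) = r ` {d' \<in> P. {d, d'} \<in> edges T}"
proof (intro set_eqI iffI)
  fix b assume "b \<in> neighbours S (r d)"
  then have b: "{b, r d} \<in> edges S" by (simp add: neighbours_def)
  then obtain d' where d': "d' \<in> P" "b = r d'" by (rule S_edgeE) blast
  then have "{d, d'} \<in> edges T" using b S_edge_iff[OF d'(1) assms] by (simp add: insert_commute)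
  then show "b \<in> r ` {d' \<in> P. {d, d'} \<in> edges T}" using d' by blast
next
  fix b assume "b \<in> r ` {d' \<in> P. {d, d'} \<in> edges T}"
  then obtain d' where d': "d' \<in> P" "{d', d} \<in> edges T" "b = r d'" by (auto simp: insert_commute)
  then show "b \<in> neighbours S (r d)"
    using S_edge_iff[OF d'(1) assms] by (simp add: neighbours_def)
qed

text \<open>Hence the separators leave room for a draw that completes them to exactly
  \<open>d - {x}\<close>.\<close>

lemma separator_union_S:
  assumes "d \<in> P"
  shows "separator_union S (r d) \<subseteq> d - {x}"
  unfolding separator_union_def neighbours_S[OF assms] using separator_S[OF assms] by auto

lemma draw_q_S:
  assumes d: "d \<in> P"
  shows "d - {x} - separator_union S (r d) \<in> set_pmf (draw_q S (r d))"
proof -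
  let ?z = "separator_union S (r d)"
  let ?q = "d - {x} - ?z"
  have "r d \<in> verts Tc" using subtree_S d by (auto simp: is_subtree_def S_def)
  then have "r d \<in> cliques (induced G (verts G - {x}))" by (simp add: Tc_eq cliques_collapsed)
  then have "r d \<subseteq> verts G"
    using cliques_complete by (fastforce simp: complete_in_def induced_def)
  then have fin: "finite (r d)" using simple by (auto simp: simple_graph_def intro: finite_subset)
  have q: "?q \<in> Pow (r d - ?z)" using r_basic(1)[OF d] by blast
  show ?thesis
  proof (cases "\<exists>b\<in>neighbours S (r d). ?z = r d \<inter> b")
    case True
    then obtain d' where d': "d' \<in> P" "{d, d'} \<in> edges T" "?z = r d \<inter> r d'"
      unfolding neighbours_S[OF d] by blast
    \<comment> \<open>Cliques are incomparable, so \<open>d\<close> has a vertex outside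
      \<open>d'\<close>. It is not \<open>x\<close>, which lies in \<open>d'\<close>, hence it
      belongs to \<open>?q\<close>, and the ban on the empty draw is respected.\<close>
    have "\<not> d \<subseteq> d'"
      using antichain[OF PD(1)[OF d] PD(1)[OF d'(1)]] simple_graphD(3)[OF simple_T d'(2)] by blast
    moreover have "?z = d \<inter> d' - {x}" using d'(3) separator_S[OF d d'(1,2)] by simp
    ultimately have "?q \<noteq> {}" using PD(2)[OF d'(1)] by blast
    then have mem: "?q \<in> Pow (r d - ?z) - {{}}" using q by blast
    then show ?thesis
      using True fin by (subst draw_q_def, simp only: Let_def if_True)
        (subst set_pmf_of_set, blast, simp, simp)
  next
    case False
    then show ?thesis
      using q fin by (subst draw_q_def, simp only: Let_def if_False)
        (subst set_pmf_of_set, blast, simp, simp)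
  qed
qed

text \<open>The neighbours outside \<open>P\<close> that the collapse handed from \<open>d\<close>
  to \<open>r d\<close>. If \<open>r d\<close> is new, the expander deletes it, passes on all its
  outer neighbours and draws the constant \<open>{}\<close>; hence the default.\<close>

definition moved :: "'v set \<Rightarrow> 'v set set" where
  "moved d = (if r d \<in> verts T then {a. {a, d} \<in> edges T \<and> x \<notin> a \<and> a \<noteq> r d} else {})"

text \<open>If \<open>a\<close> were the replacement of another node \<open>d'\<close>, it would be
  linked to both \<open>d\<close> and \<open>d'\<close>, which \<open>link_P\<close>
  excludes.\<close>

lemma link_notin_image:
  assumes "d \<in> P" "{a, d} \<in> edges T" "x \<notin> a" "a \<noteq> r d"
  shows "a \<notin> r ` P"
proof
  assume "a \<in> r ` P"
  then obtain d' where d': "d' \<in> P" "a = r d'" by blast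
  have "a \<in> verts T" using simple_graphD[OF simple_T assms(2)] by blast
  then have "{a, d'} \<in> edges T" using r_old(1)[OF d'(1)] d'(2) by simp
  then have "d = d'" using link_P assms d'(1) by blast
  then show False using assms(4) d'(2) by simp
qed

lemma outer_neighbours:
  assumes d: "d \<in> P"
  shows "a \<in> neighbours Tc (r d) - verts S \<longleftrightarrow>
    a \<notin> r ` P \<and> x \<notin> a \<and> a \<noteq> r d \<and> ({a, d} \<in> edges T \<or> {a, r d} \<in> edges T)"
proof
  assume *: "a \<in> neighbours Tc (r d) - verts S"
  then have "{a, r d} \<in> edges Tc" "a \<notin> r ` P" by (simp_all add: neighbours_def S_def)
  then obtain u v where uv: "{u, v} \<in> edges T" "\<rho> u = a" "\<rho> v = r d" "a \<noteq> r d"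
    unfolding Tc_edge_iff by blast
  note V = simple_graphD[OF simple_T uv(1)]
  have "x \<notin> u" using uv(2) V(1) \<open>a \<notin> r ` P\<close> by (auto simp: \<rho>_def P_def)
  then have "u = a" using uv(2) \<rho>_simps(2) by simp
  moreover have "v = d \<or> v = r d"
  proof (cases "x \<in> v")
    case True
    then have "v \<in> P" using V by (simp add: P_def)
    then show ?thesis using uv(3) \<rho>_simps(1) inj_onD[OF r_inj _ _ d] by metis
  qed (use uv(3) \<rho>_simps(2) in simp)
  ultimately show "a \<notin> r ` P \<and> x \<notin> a \<and> a \<noteq> r d \<and> ({a, d} \<in> edges T \<or> {a, r d} \<in> edges T)"
    using \<open>x \<notin> u\<close> \<open>a \<notin> r ` P\<close> uv(1,4) by blast
next
  assume *: "a \<notin> r ` P \<and> x \<notin> a \<and> a \<noteq> r d \<and> ({a, d} \<in> edges T \<or> {a, r d} \<in> edges T)"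
  have "\<rho> a = a" "\<rho> d = r d" "\<rho> (r d) = r d" using * \<rho>_simps d r_basic(2)[OF d] by blast+
  then have "{a, r d} \<in> edges Tc" unfolding Tc_edge_iff using * by metis
  then show "a \<in> neighbours Tc (r d) - verts S" using * by (simp add: neighbours_def S_def)
qed

text \<open>The expander may move \<open>a\<close> only if its separator with \<open>r d\<close>
  lies in \<open>d - {x}\<close>. It does, because \<open>a\<close>, \<open>d\<close>,
  \<open>r d\<close> is a path of \<open>T\<close>.\<close>

lemma moved_subset:
  assumes d: "d \<in> P"
  shows "moved d \<subseteq> {b \<in> neighbours Tc (r d) - verts S. b \<inter> r d \<subseteq> d - {x}}"
proof
  fix a assume "a \<in> moved d"
  then have a: "r d \<in> verts T" "{a, d} \<in> edges T" "x \<notin> a" "a \<noteq> r d"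
    by (auto simp: moved_def split: if_splits)
  have "{d, r d} \<in> edges T" using r_old(1)[OF d a(1)] by (simp add: insert_commute)
  then have "a \<inter> r d \<subseteq> d" by (rule junction_path3[OF jt a(2) _ a(4)])
  moreover have "a \<in> neighbours Tc (r d) - verts S"
    using outer_neighbours[OF d] link_notin_image[OF d a(2-4)] a by blast
  ultimately show "a \<in> {b \<in> neighbours Tc (r d) - verts S. b \<inter> r d \<subseteq> d - {x}}"
    using a(3) by blast
qed

text \<open>The test by which the expander deletes a node thus recovers which replacements were new:
  an old one equal to \<open>d - {x}\<close> would be a clique properly inside
  \<open>d\<close>.\<close>

lemma r_eq_iff: "d \<in> P \<Longrightarrow> d - {x} = r d \<longleftrightarrow> r d \<notin> verts T"
  using r_new[of d] antichain[of "r d" d] PD[of d] by blast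

text \<open>With the right draws all five link families of the expander consist of links of
  \<open>T\<close>. Conversely a link of \<open>T\<close> is classified by whether its ends lie in
  \<open>P\<close>, in the image of \<open>P\<close> under \<open>r\<close>, or in neither.\<close>

lemma expanded_tree_S:
  assumes f: "\<And>d. d \<in> P \<Longrightarrow> f (r d) = d - {x}" and n: "\<And>d. d \<in> P \<Longrightarrow> n (r d) = moved d"
  shows "expanded_tree x Tc S f n = T"
proof -
  let ?fp = "\<lambda>c. insert x (f c)"
  have fp: "?fp (r d) = d" if "d \<in> P" for d using f[OF that] PD(2)[OF that] by blast
  have fix_iff: "f (r d) = r d \<longleftrightarrow> r d \<notin> verts T" if "d \<in> P" for d
    using f[OF that] r_eq_iff[OF that] by simp
  have verts_S: "verts S = r ` P" by (simp add: S_def)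
  have verts: "(verts Tc - {c \<in> verts S. f c = c}) \<union> ?fp ` verts S = verts T"
  proof -
    have "{c \<in> r ` P. f c = c} = r ` P - verts T" using fix_iff by blast
    moreover have "?fp ` r ` P = P" using fp by (simp add: image_image)
    moreover have "\<rho> ` verts T = r ` P \<union> (verts T - P)" by (auto simp: \<rho>_def P_def image_iff)
    moreover have "P \<subseteq> verts T" using PD(1) by blast
    moreover have "verts Tc = \<rho> ` verts T" by (simp add: Tc_eq)
    moreover have "(r ` P \<union> (verts T - P) - (r ` P - verts T)) \<union> P = verts T"
      if "P \<subseteq> verts T" using that by blast
    ultimately show ?thesis unfolding verts_S by (simp only:)
  qed
  define A1 where "A1 = {e \<in> edges Tc. e \<inter> verts S = {}}"
  define A2 where "A2 = {{?fp c, ?fp b} | c b. {c, b} \<in> edges S}"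
  define A3 where "A3 = {{c, ?fp c} | c. c \<in> verts S \<and> f c \<noteq> c}"
  define A4 where "A4 = {{?fp c, a} | c a. c \<in> verts S \<and> a \<in> neighbours Tc c - verts S \<and> (f c = c \<or> a \<in> n c)}"
  define A5 where "A5 = {{c, a} | c a. c \<in> verts S \<and> a \<in> neighbours Tc c - verts S \<and> f c \<noteq> c \<and> a \<notin> n c}"
  have A1I: "{u, v} \<in> A1" if "{u, v} \<in> edges T" "u \<notin> P" "v \<notin> P" "u \<notin> r ` P" "v \<notin> r ` P" for u v
  proof -
    note V = simple_graphD[OF simple_T that(1)]
    have "\<rho> u = u" "\<rho> v = v" using that V by (simp_all add: \<rho>_def P_def)
    then have "{u, v} \<in> edges Tc" unfolding Tc_edge_iff using V that(1) by blast
    then show ?thesis using that by (simp add: A1_def verts_S)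
  qed
  have A2I: "{d, d'} \<in> A2" if "d \<in> P" "d' \<in> P" "{d, d'} \<in> edges T" for d d'
    unfolding A2_def
    by (intro CollectI exI[of _ "r d"] exI[of _ "r d'"]) (simp only: fp that S_edge_iff simp_thms)
  have A3I: "{r d, d} \<in> A3" if "d \<in> P" "r d \<in> verts T" for d
    unfolding A3_def
    by (intro CollectI exI[of _ "r d"]) (use that in \<open>simp add: fp fix_iff verts_S\<close>)
  have A4I: "{d, a} \<in> A4" if d: "d \<in> P" "{a, d} \<in> edges T" "a \<notin> P" "a \<noteq> r d" for d a
  proof -
    have x: "x \<notin> a" using that(3) simple_graphD[OF simple_T that(2)] by (simp add: P_def)
    have "a \<in> neighbours Tc (r d) - verts S"
      using outer_neighbours[OF d(1)] link_notin_image[OF d(1,2) x d(4)] d x by blast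
    moreover have "f (r d) = r d \<or> a \<in> n (r d)"
      using fix_iff[OF d(1)] n[OF d(1)] d x by (simp add: moved_def)
    ultimately show ?thesis
      unfolding A4_def
      by (intro CollectI exI[of _ "r d"] exI[of _ a]) (use d in \<open>simp add: fp verts_S\<close>)
  qed
  have A5I: "{r d, a} \<in> A5"
    if d: "d \<in> P" "{r d, a} \<in> edges T" "a \<notin> P" for d a
  proof -
    note V = simple_graphD[OF simple_T d(2)]
    have x: "x \<notin> a" using d(3) V by (simp add: P_def)
    have rd: "{r d, d} \<in> edges T" by (rule r_old(1)[OF d(1) V(1)])
    have ad: "{a, r d} \<in> edges T" using d(2) by (simp add: insert_commute)
    \<comment> \<open>A link between \<open>r d\<close> and another old replacement
      \<open>a = r d'\<close> would make \<open>d\<close>, \<open>r d\<close>, \<open>a\<close>,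
      \<open>d'\<close> a path with \<open>x\<close> at both ends but not in
      \<open>r d\<close>.\<close>
    have no_image: "a \<notin> r ` P"
    proof
      assume "a \<in> r ` P"
      then obtain d' where d': "d' \<in> P" "a = r d'" by blast
      then have a': "{a, d'} \<in> edges T" using r_old(1)[OF d'(1)] V by simp
      have "d \<noteq> d'" using V d' by blast
      have "{d, r d} \<in> edges T" using rd by (simp add: insert_commute)
      moreover have "d \<noteq> a" "r d \<noteq> d'" using d d' r_basic(3) by blast+
      ultimately have "d \<inter> d' \<subseteq> r d" using junction_path4(1)[OF jt _ d(2) a'] by blast
      then show False using PD(2) d(1) d'(1) r_basic(2)[OF d(1)] by blast
    qed
    \<comment> \<open>A neighbour of \<open>r d\<close> that was also linked to \<open>d\<close>
      would close a triangle, so \<open>a\<close> is not among the moved nodes.\<close>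
    have nad: "{a, d} \<notin> edges T"
      using tree_no_triangle[OF tree ad rd] by blast
    have "a \<in> neighbours Tc (r d) - verts S"
      using outer_neighbours[OF d(1)] no_image x V ad by blast
    moreover have "f (r d) \<noteq> r d" using fix_iff[OF d(1)] V by simp
    moreover have "a \<notin> n (r d)" using n[OF d(1)] nad by (simp add: moved_def)
    ultimately show ?thesis
      unfolding A5_def
      by (intro CollectI exI[of _ "r d"] exI[of _ a]) (use d in \<open>simp add: verts_S\<close>)
  qed
  have edges: "A1 \<union> A2 \<union> A3 \<union> A4 \<union> A5 = edges T"
  proof
    have "A1 \<subseteq> edges T"
    proof
      fix e assume e: "e \<in> A1"
      then have "e \<in> edges Tc" "e \<inter> r ` P = {}" by (simp_all add: A1_def verts_S)
      moreover from this(1) obtain c a where ca: "e = {c, a}"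
        using tree_Tc by (metis is_tree_iff simple_graph_edgeE)
      ultimately obtain u v where uv: "{u, v} \<in> edges T" "\<rho> u = c" "\<rho> v = a" "c \<notin> r ` P" "a \<notin> r ` P"
        unfolding Tc_edge_iff by (auto simp: Tc_edge_iff)
      note V = simple_graphD[OF simple_T uv(1)]
      have "u = c" "v = a" using uv V by (auto simp: \<rho>_def P_def split: if_splits)
      then show "e \<in> edges T" using uv(1) ca by simp
    qed
    moreover have "A2 \<subseteq> edges T"
    proof
      fix e assume "e \<in> A2"
      then obtain c b where "{c, b} \<in> edges S" "e = {?fp c, ?fp b}" by (auto simp: A2_def)
      then show "e \<in> edges T" by (elim S_edgeE) (simp only: fp)
    qed
    moreover have "A3 \<subseteq> edges T"
    proof
      fix e assume "e \<in> A3"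
      then obtain d where "d \<in> P" "e = {r d, ?fp (r d)}" "f (r d) \<noteq> r d"
        by (auto simp: A3_def verts_S)
      then show "e \<in> edges T" using r_old(1)[of d] fix_iff[of d] by (simp only: fp) blast
    qed
    moreover have "A4 \<subseteq> edges T"
    proof
      fix e assume "e \<in> A4"
      then obtain d a where d: "d \<in> P" "e = {?fp (r d), a}" "a \<in> neighbours Tc (r d) - verts S"
        "f (r d) = r d \<or> a \<in> n (r d)"
        unfolding A4_def verts_S by blast
      then have "r d \<notin> verts T \<or> a \<in> moved d" using fix_iff n by simp
      then have "{a, d} \<in> edges T"
      proof
        assume "r d \<notin> verts T"
        then have "{a, r d} \<notin> edges T" using simple_graphD[OF simple_T] by blast
        then show ?thesis using outer_neighbours[OF d(1)] d(3) by blast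
      qed (auto simp: moved_def split: if_splits)
      then show "e \<in> edges T" using d(1,2) fp by (simp add: insert_commute)
    qed
    moreover have "A5 \<subseteq> edges T"
    proof
      fix e assume "e \<in> A5"
      then obtain d a where d: "d \<in> P" "e = {r d, a}" "a \<in> neighbours Tc (r d) - verts S"
        "f (r d) \<noteq> r d" "a \<notin> n (r d)"
        unfolding A5_def verts_S by blast
      then have "r d \<in> verts T" "a \<notin> moved d" using fix_iff n by simp_all
      then have "{a, r d} \<in> edges T"
        using outer_neighbours[OF d(1)] d(3) unfolding moved_def by auto
      then show "e \<in> edges T" using d(2) by (simp add: insert_commute)
    qed
    ultimately show "A1 \<union> A2 \<union> A3 \<union> A4 \<union> A5 \<subseteq> edges T" by blast
  next
    \<comment> \<open>Every link meets this condition in at least one of its two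
      orientations.\<close>
    have sorted: "{u, v} \<in> A1 \<union> A2 \<union> A3 \<union> A4 \<union> A5"
      if uv: "{u, v} \<in> edges T" and "u \<in> P \<or> v \<notin> P \<and> (u \<in> r ` P \<or> v \<notin> r ` P)" for u v
    proof (cases "u \<in> P")
      case True
      then show ?thesis
      proof (cases "v \<in> P"; cases "v = r u")
        assume "v \<notin> P" "v = r u"
        then show ?thesis
          using A3I[OF True] simple_graphD[OF simple_T uv] by (simp add: insert_commute)
      next
        assume "v \<notin> P" "v \<noteq> r u"
        then have "{u, v} \<in> A4" using A4I[OF True, of v] uv by (simp add: insert_commute)
        then show ?thesis by blast
      qed (use A2I[OF True _ uv] in blast)+
    next
      case False
      show ?thesis
      proof (cases "u \<in> r ` P")
        case True
        then show ?thesis using A5I uv that False by blast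
      qed (use A1I uv that False in blast)
    qed
    show "edges T \<subseteq> A1 \<union> A2 \<union> A3 \<union> A4 \<union> A5"
    proof
      fix e assume e: "e \<in> edges T"
      then obtain u v where uv: "e = {u, v}" using simple_T by (metis simple_graph_edgeE)
      then have "{u, v} \<in> edges T" "{v, u} \<in> edges T" using e by (simp_all add: insert_commute)
      then have "{u, v} \<in> A1 \<union> A2 \<union> A3 \<union> A4 \<union> A5 \<or> {v, u} \<in> A1 \<union> A2 \<union> A3 \<union> A4 \<union> A5"
        using sorted by blast
      then show "e \<in> A1 \<union> A2 \<union> A3 \<union> A4 \<union> A5" using uv by (simp add: insert_commute)
    qed
  qed
  show ?thesis
    unfolding expanded_tree_def Let_def verts
    using edges by (simp only: A1_def A2_def A3_def A4_def A5_def prod.collapse)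
qed

lemma expand_S: "T \<in> set_pmf (expand_nonempty x Tc S)"
proof -
  define s where "s = inv_into P r"
  have s: "s (r d) = d" if "d \<in> P" for d
    unfolding s_def by (rule inv_into_f_f[OF r_inj that])
  have verts_S: "verts S = r ` P" by (simp add: S_def)
  have fin: "finite (verts S)" using finite_P by (simp add: verts_S)
  \<comment> \<open>\<open>Pi_pmf\<close> is supported on families with value \<open>{}\<close>
    outside the index set, hence the default in \<open>q\<close> and \<open>n\<close>. Inside,
    \<open>q\<close> completes the separators to \<open>d - {x}\<close>.\<close>
  define q where "q = (\<lambda>c. if c \<in> verts S then s c - {x} - separator_union S c else {})"
  define n where "n = (\<lambda>c. if c \<in> verts S then moved (s c) else {})"
  define f where "f = (\<lambda>c. separator_union S c \<union> q c)"
  have f: "f (r d) = d - {x}" if "d \<in> P" for d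
    using separator_union_S[OF that] that by (auto simp: f_def q_def verts_S s)
  have n_r: "n (r d) = moved d" if "d \<in> P" for d
    using that by (simp add: n_def verts_S s)
  have "q \<in> set_pmf (Pi_pmf (verts S) {} (draw_q S))"
    unfolding set_Pi_pmf[OF fin] PiE_dflt_def
    using draw_q_S by (auto simp: q_def verts_S s)
  moreover have "n \<in> set_pmf (Pi_pmf (verts S) {} (\<lambda>c. if f c = c then return_pmf {}
      else pmf_of_set (Pow {b \<in> neighbours Tc c - verts S. b \<inter> c \<subseteq> f c})))"
  proof -
    have "n c \<in> set_pmf (if f c = c then return_pmf {}
      else pmf_of_set (Pow {b \<in> neighbours Tc c - verts S. b \<inter> c \<subseteq> f c}))" if "c \<in> verts S" for c
    proof -
      obtain d where d: "d \<in> P" "c = r d" using \<open>c \<in> verts S\<close> by (auto simp: verts_S)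
      show ?thesis
      proof (cases "f c = c")
        case True
        \<comment> \<open>The draw is the constant \<open>{}\<close> here, so \<open>moved\<close>
          must be empty for a new replacement.\<close>
        then have "r d \<notin> verts T" using f d r_eq_iff by simp
        then show ?thesis using True n_r d by (simp add: moved_def)
      next
        case False
        have simple_Tc: "simple_graph Tc" using tree_Tc by (simp only: is_tree_def)
        then have "neighbours Tc c \<subseteq> verts Tc"
          using simple_graphD(1)[OF simple_Tc] by (auto simp only: neighbours_def mem_Collect_eq)
        moreover have "finite (verts Tc)" using simple_Tc by (simp only: simple_graph_def)
        ultimately have "finite (Pow {b \<in> neighbours Tc c - verts S. b \<inter> c \<subseteq> f c})"
          by (simp add: finite_subset)
        moreover have "n c \<in> Pow {b \<in> neighbours Tc c - verts S. b \<inter> c \<subseteq> f c}"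
          using moved_subset[OF d(1)] f[OF d(1)] n_r[OF d(1)] unfolding d(2) by blast
        ultimately show ?thesis using False by (simp only: if_False) (subst set_pmf_of_set; blast)
      qed
    qed
    then show ?thesis
      unfolding set_Pi_pmf[OF fin] PiE_dflt_def by (auto simp: n_def)
  qed
  moreover have "T = expanded_tree x Tc S f n" by (rule expanded_tree_S[OF f n_r, symmetric])
  ultimately show ?thesis
    unfolding expand_nonempty_def Let_def set_bind_pmf f_def by (auto intro!: bexI)
qed

end


section \<open>Collapsing an isolated vertex\<close>

text \<open>\<open>others\<close> reflects \<open>1 \<le> m\<close>: without other vertices no node
  would remain, whereas the graph without vertices still has the clique \<open>{}\<close>.\<close>

locale isolated_vertex =
  fixes G :: "'v graph" and T :: "'v set graph" and x :: 'v
  assumes simple: "simple_graph G"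
    and jt: "junction_tree_of G T"
    and isolated: "{x} \<in> verts T"
    and others: "verts G - {x} \<noteq> {}"
begin

abbreviation F :: "'v set graph" where "F \<equiv> induced T (verts T - {{x}})"

lemma tree: "is_tree T" and verts_eq: "verts T = cliques G" and vconn: "vconn T"
  using jt by (simp_all add: junction_tree_of_iff)

lemma simple_T: "simple_graph T"
  using tree by (simp add: is_tree_iff)

lemma verts_F: "verts F = verts T - {{x}}"
  by (auto simp: induced_def)

lemma edges_F: "edges F \<subseteq> edges T"
  by (auto simp: induced_def)

lemma notin_other: "c \<in> verts F \<Longrightarrow> x \<notin> c"
  using cliques_antichain[of "{x}" G c] isolated verts_eq verts_F by auto

lemma cliques_others: "cliques (induced G (verts G - {x})) = verts F"
proof -
  let ?G = "induced G (verts G - {x})"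
  have fin: "finite (verts G)" using simple by (simp add: simple_graph_def)
  note complete = complete_in_remove_iff[of G x]
  show ?thesis
  proof
    show "verts F \<subseteq> cliques ?G"
    proof
      fix W assume W: "W \<in> verts F"
      then have "W \<in> cliques G" "x \<notin> W" using notin_other verts_eq verts_F by auto
      then show "W \<in> cliques ?G" by (simp add: cliques_def complete)
    qed
  next
    show "cliques ?G \<subseteq> verts F"
    proof
      fix W assume W: "W \<in> cliques ?G"
      then have c: "complete_in G W" "x \<notin> W"
        using cliques_complete complete by blast+
      obtain a where a: "a \<in> cliques G" "W \<subseteq> a" using complete_in_extends[OF fin c(1)] by blast
      \<comment> \<open>A nonempty \<open>W\<close> without \<open>x\<close> cannot extend to
        \<open>{x}\<close>, the clique that is removed.\<close>
      have "W \<noteq> {}" using clique_nonempty[OF _ W] others by (auto simp: induced_def)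
      then have "a \<noteq> {x}" using a(2) c(2) by blast
      then have aF: "a \<in> verts F" using a(1) verts_eq verts_F by simp
      then have "complete_in ?G a" using cliques_complete[OF a(1)] notin_other complete by blast
      then have "a = W" using W a(2) unfolding cliques_def by blast
      then show "W \<in> verts F" using aF by simp
    qed
  qed
qed

lemma verts_F_nonempty: "verts F \<noteq> {}"
proof -
  have "complete_in (induced G (verts G - {x})) {}" by (simp add: complete_in_def)
  moreover have "finite (verts (induced G (verts G - {x})))"
    using simple by (simp add: simple_graph_def induced_def)
  ultimately show ?thesis using complete_in_extends cliques_others by blast
qed

text \<open>The node \<open>{x}\<close> contains no vertex but \<open>x\<close>, so no connection
  for another vertex passes through it.\<close>

lemma vconn_F: "vconn F"
  unfolding vconn_def
proof (intro allI ballI impI)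
  fix v c c'
  assume *: "c \<in> verts F" "c' \<in> verts F" "v \<in> c" "v \<in> c'"
  then have "v \<noteq> x" using notin_other by blast
  have "conn {e \<in> edges T. \<forall>b\<in>e. v \<in> b} c c'"
    using vconn * verts_F by (simp add: vconn_def)
  then show "conn {e \<in> edges F. \<forall>b\<in>e. v \<in> b} c c'"
  proof (rule conn_mono)
    show "{e \<in> edges T. \<forall>b\<in>e. v \<in> b} \<subseteq> {e \<in> edges F. \<forall>b\<in>e. v \<in> b}"
    proof (intro subsetI CollectI conjI)
      fix e assume e: "e \<in> {e \<in> edges T. \<forall>b\<in>e. v \<in> b}"
      then have "{x} \<notin> e" using \<open>v \<noteq> x\<close> by blast
      moreover have "e \<subseteq> verts T" using e simple_T by (simp add: simple_graph_def)
      ultimately show "e \<in> edges F" using e by (auto simp: induced_def)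
      show "\<forall>b\<in>e. v \<in> b" using e by blast
    qed
  qed
qed

lemma junction_tree_completion:
  assumes "T' \<in> tree_completions F"
  shows "junction_tree_of (induced G (verts G - {x})) T'"
  using assms vconn_mono[OF vconn_F, of T']
  by (simp only: tree_completions_def mem_Collect_eq junction_tree_of_iff cliques_others simp_thms)

text \<open>Two nodes with a common vertex are connected in \<open>F\<close> already, so a link
  added between them would not be a bridge.\<close>

lemma separated_link_completion:
  assumes T': "T' \<in> tree_completions F" and e: "e \<in> edges T'" "\<Inter>e \<noteq> {}"
  shows "e \<in> edges T"
proof (rule ccontr)
  assume "e \<notin> edges T"
  have tree': "is_tree T'" "verts T' = verts F" "edges F \<subseteq> edges T'"
    using T' by (simp_all add: tree_completions_def)
  then have s: "simple_graph T'" by (simp add: is_tree_iff)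
  obtain a b where ab: "e = {a, b}" "a \<in> verts T'" "b \<in> verts T'"
    using s e(1) by (metis simple_graph_edgeE)
  obtain v where "v \<in> a" "v \<in> b" using e(2) ab(1) by auto
  then have "conn {e \<in> edges F. \<forall>b\<in>e. v \<in> b} a b"
    using vconn_F ab tree'(2) by (simp add: vconn_def)
  then have "conn (edges T' - {{a, b}}) a b"
    by (rule conn_mono) (use tree'(3) edges_F \<open>e \<notin> edges T\<close> ab(1) in blast)
  then show False using tree_bridge[OF tree'(1)] e(1) ab(1) by blast
qed

text \<open>Contracting one link at \<open>{x}\<close> gives a completion: a neighbour
  \<open>b\<close> takes over the other neighbours of \<open>{x}\<close>.\<close>

lemma completions_nonempty: "tree_completions F \<noteq> {}"
proof -
  obtain a where "a \<in> verts F" using verts_F_nonempty by blast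
  then have "a \<in> verts T" "a \<noteq> {x}" by (simp_all add: verts_F)
  then obtain b where b: "{b, {x}} \<in> edges T"
    using tree_first_link[OF jt _ isolated] by metis
  define f where "f c = (if c = {x} then b else c)" for c
  have bT: "b \<in> verts T" "b \<noteq> {x}" using simple_graphD[OF simple_T b] by auto
  have f_cases: "u = v \<or> {u, v} = {b, {x}}" if "f u = f v" for u v
    using that by (auto simp: f_def split: if_splits)
  have "is_tree (f ` verts T, (\<lambda>e. f ` e) ` (edges T - {{b, {x}}}))"
  proof (rule contraction_is_tree[OF tree])
    show "{{b, {x}}} \<subseteq> edges T" using b by simp
  next
    fix u v assume uv: "{u, v} \<in> edges T"
    show "f u = f v \<longleftrightarrow> {u, v} \<in> {{b, {x}}}"
    proof
      assume "f u = f v"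
      from f_cases[OF this] show "{u, v} \<in> {{b, {x}}}" using simple_graphD(3)[OF simple_T uv] by blast
    qed (use bT in \<open>auto simp: f_def doubleton_eq_iff\<close>)
  next
    fix u v assume "f u = f v"
    from f_cases[OF this] show "conn {{b, {x}}} u v"
    proof
      assume "{u, v} = {b, {x}}"
      then show ?thesis by (intro conn_edge) simp
    qed simp
  qed
  moreover have "f ` verts T = verts F"
    using bT by (auto simp: f_def verts_F image_iff)
  moreover have "edges F \<subseteq> (\<lambda>e. f ` e) ` (edges T - {{b, {x}}})"
  proof
    fix e assume "e \<in> edges F"
    then have e: "e \<in> edges T" "{x} \<notin> e" by (auto simp: induced_def)
    have "f ` e = (\<lambda>c. c) ` e" by (rule image_cong) (use e(2) in \<open>auto simp: f_def\<close>)
    then have "f ` e = e" by simp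
    moreover have "e \<in> edges T - {{b, {x}}}" using e by blast
    ultimately show "e \<in> (\<lambda>e. f ` e) ` (edges T - {{b, {x}}})" by (metis imageI)
  qed
  ultimately have "(f ` verts T, (\<lambda>e. f ` e) ` (edges T - {{b, {x}}})) \<in> tree_completions F"
    by (simp only: tree_completions_def mem_Collect_eq fst_conv snd_conv simp_thms)
  then show ?thesis by blast
qed

lemma finite_F: "finite (verts F)"
  using simple_T verts_F by (simp add: simple_graph_def)

lemma expand_completion:
  assumes T': "T' \<in> tree_completions F"
  shows "T \<in> set_pmf (expand_empty x T')"
proof -
  define c where "c = (SOME c. c \<in> verts T')"
  have verts_T': "verts T' = verts F" using T' by (simp add: tree_completions_def)
  then have "c \<in> verts F" unfolding c_def using verts_F_nonempty by (metis all_not_in_conv someI)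
  then have "x \<notin> c" by (rule notin_other)
  let ?F' = "(insert {x} (verts T'), {e \<in> insert {{x}, c} (edges T'). \<Inter>e \<noteq> {}})"
  \<comment> \<open>The auxiliary link at \<open>{x}\<close> has empty separator because
    \<open>x \<notin> c\<close>, and so have all links that the completion added; only links of
    \<open>T\<close> survive the deletion.\<close>
  have "edges ?F' \<subseteq> edges T"
    using separated_link_completion[OF T'] \<open>x \<notin> c\<close> by auto
  moreover have "verts ?F' = verts T"
    using verts_T' verts_F isolated by auto
  ultimately have T: "T \<in> tree_completions ?F'" using tree by (simp add: tree_completions_def)
  have "finite (tree_completions ?F')"
    by (rule finite_tree_completions) (simp add: verts_T' finite_F)
  then have "T \<in> set_pmf (pmf_of_set (tree_completions ?F'))"
    using T by (subst set_pmf_of_set) auto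
  then show ?thesis unfolding expand_empty_def Let_def c_def .
qed

end


section \<open>Supports of the two kernels\<close>

lemma finite_subtrees:
  assumes "simple_graph T"
  shows "finite {T'. is_subtree T' T}"
proof (rule finite_subset)
  show "{T'. is_subtree T' T} \<subseteq> Pow (verts T) \<times> Pow (edges T)"
    by (auto simp: is_subtree_def)
  have "edges T \<subseteq> Pow (verts T)" using assms by (auto simp: simple_graph_def)
  then show "finite (Pow (verts T) \<times> Pow (edges T))"
    using assms by (auto simp: simple_graph_def intro: finite_subset)
qed

text \<open>The sum is finite with nonnegative terms, so one positive term suffices. Parameters
  strictly between 0 and 1 give every subtree a positive weight.\<close>

lemma expander_prob_pos:
  assumes "0 < \<alpha>" "\<alpha> < 1" "0 < \<beta>" "\<beta> < 1" and T: "simple_graph T"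
    and T': "is_subtree T' T" and mem: "T_plus \<in> set_pmf (expand_along (y (m + 1)) T T')"
  shows "0 < expander_prob y \<alpha> \<beta> m T T_plus"
  unfolding expander_prob_def
proof (rule sum_pos2[OF finite_subtrees[OF T], of T'])
  show "T' \<in> {T'. is_subtree T' T}" using T' by simp
  have "0 < subtree_kernel \<alpha> \<beta> T T'"
  proof (cases "T' = ({}, {})")
    case True
    then show ?thesis using T' assms by (simp add: subtree_kernel_def)
  next
    case False
    have s: "simple_graph T'" "verts T' \<subseteq> verts T" using T' by (simp_all add: is_subtree_def)
    have "verts T' \<noteq> {}"
    proof
      assume v: "verts T' = {}"
      then have "edges T' = {}" using s(1) by (auto simp: simple_graph_def)
      then show False using v False by (simp add: prod_eq_iff)
    qed
    moreover have "finite (verts T)" using T by (simp add: simple_graph_def)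
    ultimately have "0 < card (verts T')" "0 < card (verts T)"
      using s(2) by (auto simp: card_gt_0_iff intro: finite_subset)
    then show ?thesis using False T' assms by (simp add: subtree_kernel_def)
  qed
  moreover have "0 < pmf (expand_along (y (m + 1)) T T') T_plus"
    using mem by (simp add: pmf_positive_iff)
  ultimately show "0 < subtree_kernel \<alpha> \<beta> T T' * pmf (expand_along (y (m + 1)) T T') T_plus"
    by simp
  show "0 \<le> subtree_kernel \<alpha> \<beta> T T'' * pmf (expand_along (y (m + 1)) T T'') T_plus" for T''
    using assms by (simp add: subtree_kernel_def)
qed

lemma collapse_support:
  assumes G: "simple_graph G" "junction_tree_of G Tp" "x \<in> verts G" "verts G - {x} \<noteq> {}"
    and T: "T \<in> set_pmf (collapse x Tp)"
  shows "junction_tree_of (induced G (verts G - {x})) T"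
    and "\<exists>T'. is_subtree T' T \<and> Tp \<in> set_pmf (expand_along x T T')"
proof -
  have "junction_tree_of (induced G (verts G - {x})) T \<and>
    (\<exists>T'. is_subtree T' T \<and> Tp \<in> set_pmf (expand_along x T T'))"
  proof (cases "{x} \<in> verts Tp")
    case True
    then interpret isolated_vertex G Tp x
      by (unfold_locales) (use G in blast)+
    have T: "T \<in> tree_completions F"
      using T True completions_nonempty finite_tree_completions[OF finite_F]
      by (simp add: collapse_def)
    have "is_subtree ({}, {}) T"
      by (simp add: is_subtree_def simple_graph_def graph_connected_def)
    moreover have "Tp \<in> set_pmf (expand_along x T ({}, {}))"
      using expand_completion[OF T] by (simp add: expand_along_def)
    ultimately show ?thesis using junction_tree_completion[OF T] by blast
  next
    case False
    have "is_tree Tp" using G(2) by (simp only: junction_tree_of_iff)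
    then have simple_Tp: "simple_graph Tp" by (simp only: is_tree_def)
    then have fin: "finite (verts Tp)" by (simp only: simple_graph_def)
    define M where "M d = {c \<in> neighbours Tp d. c \<inter> d = d - {x}}" for d
    have fin_M: "finite (M d)" for d
    proof (rule finite_subset[OF _ fin])
      show "M d \<subseteq> verts Tp"
        using simple_graphD(1)[OF simple_Tp] unfolding M_def neighbours_def by blast
    qed
    let ?P = "{d \<in> verts Tp. x \<in> d}"
    let ?p = "\<lambda>d. if M d = {} then return_pmf (d - {x}) else pmf_of_set (M d)"
    have "collapse x Tp = Pi_pmf ?P {} ?p \<bind> (\<lambda>r. return_pmf (collapsed_tree x Tp r))"
      unfolding collapse_def Let_def M_def using False by (simp only: if_False)
    then obtain r where r: "r \<in> set_pmf (Pi_pmf ?P {} ?p)" and T_eq: "T = collapsed_tree x Tp r"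
      using T by auto
    have "finite ?P" using fin by simp
    from r have r_mem: "r d \<in> set_pmf (?p d)" if "d \<in> verts Tp" "x \<in> d" for d
      using that unfolding set_Pi_pmf[OF \<open>finite ?P\<close>] PiE_dflt_def by simp
    interpret collapse_choice G Tp x r
    proof
      fix d assume "d \<in> verts Tp" "x \<in> d"
      from r_mem[OF this] have "if M d = {} then r d = d - {x} else r d \<in> M d"
        using fin_M by (cases "M d = {}") simp_all
      then show "if {c \<in> neighbours Tp d. c \<inter> d = d - {x}} = {} then r d = d - {x}
        else r d \<in> {c \<in> neighbours Tp d. c \<inter> d = d - {x}}"
        by (simp only: M_def)
    qed (rule G)+
    \<comment> \<open>Some clique contains \<open>x\<close>, so \<open>S\<close> has a node and the
      expander takes its nonempty branch.\<close>
    have "complete_in G {x}" "finite (verts G)"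
      using G(1,3) by (simp_all add: complete_in_def simple_graph_def)
    then obtain d where "d \<in> cliques G" "x \<in> d" using complete_in_extends by blast
    then have "d \<in> P" using verts_eq by (simp add: P_def)
    then have "S \<noteq> ({}, {})" by (auto simp: S_def)
    then have "Tp \<in> set_pmf (expand_along x T S)"
      using expand_S T_eq by (simp only: expand_along_def if_False)
    then show ?thesis using junction_tree_Tc subtree_S T_eq by blast
  qed
  then show "junction_tree_of (induced G (verts G - {x})) T"
    and "\<exists>T'. is_subtree T' T \<and> Tp \<in> set_pmf (expand_along x T T')" by blast+
qed

theorem theorem3:
  fixes y :: "nat \<Rightarrow> 'v" and \<alpha> \<beta> :: real and m :: nat and T_plus :: "'v set graph"
  assumes "inj_on y {1..}"
    and "0 < \<alpha>" "\<alpha> < 1" "0 < \<beta>" "\<beta> < 1"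
    and "1 \<le> m"
    and "T_plus \<in> junction_trees y (m + 1)"
  shows "Supp (\<lambda>T. collapser_prob y m T_plus T) \<subseteq> junction_trees y m
    \<and> Supp (\<lambda>T. collapser_prob y m T_plus T) \<subseteq> Supp (\<lambda>T. expander_prob y \<alpha> \<beta> m T T_plus)
    \<and> (\<forall>T \<in> Supp (\<lambda>T. collapser_prob y m T_plus T).
          underlying_graph T = induced (underlying_graph T_plus) (y ` {1..m}))"
proof -
  let ?x = "y (m + 1)"
  obtain G where G: "simple_graph G" "verts G = y ` {1..m + 1}" "junction_tree_of G T_plus"
    using assms(7) by (auto simp: junction_trees_def)
  \<comment> \<open>Since the vertices are distinct, removing the last one leaves exactly the first
    \<open>m\<close>.\<close>
  have "?x \<notin> y ` {1..m}"
  proof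
    assume "?x \<in> y ` {1..m}"
    then obtain i where i: "i \<in> {1..m}" "?x = y i" by blast
    then have "m + 1 = i" using inj_onD[OF assms(1) i(2)] by simp
    then show False using i(1) by simp
  qed
  moreover have "y ` {1..m + 1} = insert ?x (y ` {1..m})"
    by (simp add: atLeastAtMostSuc_conv)
  ultimately have old: "verts G - {?x} = y ` {1..m}" using G(2) by simp
  have others: "?x \<in> verts G" "verts G - {?x} \<noteq> {}" using assms(6) old G(2) by auto
  define H where "H = induced G (y ` {1..m})"
  have H: "simple_graph H" "verts H = y ` {1..m}"
    using simple_graph_induced[OF G(1)] old by (auto simp: H_def induced_def)
  have G_eq: "underlying_graph T_plus = G"
    using underlying_graph_of_cliques[OF G(1)] G(3) by (simp only: junction_tree_of_iff)
  have Supp_collapse: "T \<in> set_pmf (collapse ?x T_plus)"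
    if "T \<in> Supp (\<lambda>T. collapser_prob y m T_plus T)" for T
    using that by (simp add: Supp_def collapser_prob_def pmf_positive_iff)
  note support = collapse_support[OF G(1,3) others Supp_collapse, unfolded old, folded H_def]
  show ?thesis
  proof (intro conjI subsetI ballI)
    fix T assume T: "T \<in> Supp (\<lambda>T. collapser_prob y m T_plus T)"
    show "T \<in> junction_trees y m"
      using support(1)[OF T] H unfolding junction_trees_def decomposable_def by blast
    have "is_tree T" using support(1)[OF T] by (simp only: junction_tree_of_iff)
    then have "simple_graph T" by (simp only: is_tree_def)
    moreover obtain T' where "is_subtree T' T" "T_plus \<in> set_pmf (expand_along ?x T T')"
      using support(2)[OF T] by blast
    ultimately show "T \<in> Supp (\<lambda>T. expander_prob y \<alpha> \<beta> m T T_plus)"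
      unfolding Supp_def by (intro CollectI expander_prob_pos[OF assms(2-5)])
    show "underlying_graph T = induced (underlying_graph T_plus) (y ` {1..m})"
      using support(1)[OF T] underlying_graph_of_cliques[OF H(1)] G_eq
      by (simp only: junction_tree_of_iff H_def)
  qed
qed

end
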